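(* For every multigraph $G$, $\lambda(G)=\nu(G)-1$.
   Context: A multigraph is a finite undirected graph that may contain parallel edges but no loops. A tensegrity realization of $G$ in $\mathbb{R}^d$ is a triple $(G,\sigma,p)$ with $\sigma:E(G)\to\{+,-\}$ and $p:V(G)\to\mathbb{R}^d$ (not necessarily injective). Write $V(G)=\{1,\dots,n\}$, $\mathbf{e}_i$ the standard basis of $\mathbb{R}^n$. For $\omega:E(G)\to\mathbb{R}$, $L_{G,\omega}=\sum_{e\in E(G)}\omega(e)(\mathbf{e}_i-\mathbf{e}_j)(\mathbf{e}_i-\mathbf{e}_j)^\top$ ($i,j$ the endpoints of $e$). $\omega$ is an equilibrium stress if $\sum_{e \text{ joins } i,j}\omega(e)(p(j)-p(i))=0$ for every vertex $i$, strictly proper if $\sigma(e)\omega(e)>0$ for all $e$. $(G,\sigma,p)$ with $p(V(G))$ affinely spanning $\mathbb{R}^d$ is a $d$-dimensional super stable tensegrity if (i) some strictly proper equilibrium stress $\omega$ has $L_{G,\omega}\succeq0$ and $\dim\ker L_{G,\omega}=d+1$, and (ii) no nonzero symmetric $d\times d$ matrix $S$ satisfies $(p(j)-p(i))^\top S(p(j)-p(i))=0$ for all edges $ij$. For connected $G$, $\lambda(G)$ is the maximum $d$ such that $G$ has a $d$-dimensional super stable tensegrity realization; for general $G$, $\lambda(G)$ is the maximum of $\lambda(H)$ over connected components $H$ of $G$. Colin de Verdière number: let $\mathcal{A}^*(G)$ be the set of symmetric $n\times n$ matrices $A$ with $A[i,j]=0$ if $i\ne j$ and there is no edge between $i,j$;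 $A[i,j]\neq 0$ if there is exactly one edge between $i,j$; $A[i,j]$ arbitrary if there are at least two edges between $i,j$ or $i=j$. $A$ has the Strong Arnold Property (SAP) if there is no nonzero symmetric $X$ with $XA=0$ and $X[i,j]=0$ whenever $i=j$ or $i,j$ are adjacent. Then $\nu(G)=\max\{\dim\ker A: A\in\mathcal{A}^*(G),\ A\succeq 0,\ A \text{ has the SAP}\}$. *)

theory Defs
  imports "HOL-Analysis.Analysis"
begin

text \<open>
  Edges are abstract objects carrying a two-element set of endpoints, so parallel edges are
  allowed and loops are not.  The vertex type is finite so that the matrices below live in
  \<open>real ^ 'v ^ 'v\<close>; the vertex set may be a proper subset of the type, because connected
  components have to be multigraphs over the same type.
\<close>

record ('v, 'e) mgraph =
  verts :: "'v set"
  edges :: "'e set"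
  ends :: "'e \<Rightarrow> 'v set"

definition multigraph :: "('v, 'e) mgraph \<Rightarrow> bool" where
  "multigraph G \<longleftrightarrow> finite (verts G) \<and> finite (edges G) \<and>
     (\<forall>e\<in>edges G. ends G e \<subseteq> verts G \<and> card (ends G e) = 2)"

definition joining :: "('v, 'e) mgraph \<Rightarrow> 'v \<Rightarrow> 'v \<Rightarrow> 'e set" where
  "joining G i j = {e \<in> edges G. ends G e = {i, j}}"

definition adj :: "('v, 'e) mgraph \<Rightarrow> ('v \<times> 'v) set" where
  "adj G = {(i, j). joining G i j \<noteq> {}}"

definition induced :: "('v, 'e) mgraph \<Rightarrow> 'v set \<Rightarrow> ('v, 'e) mgraph" where
  "induced G C = G\<lparr>verts := C, edges := {e \<in> edges G. ends G e \<subseteq> C}\<rparr>"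

definition conn_components :: "('v, 'e) mgraph \<Rightarrow> ('v, 'e) mgraph set" where
  "conn_components G = induced G ` (verts G // ((adj G)\<^sup>* \<inter> verts G \<times> verts G))"

text \<open>
  For a vertex set \<open>V\<close>, the space of real vectors indexed by \<open>V\<close> is the coordinate subspace
  \<open>vecs_on V\<close>, and a \<open>V\<close>-by-\<open>V\<close> matrix is a matrix vanishing outside \<open>V \<times> V\<close>.  Kernels are
  always taken inside \<open>vecs_on V\<close>; the coordinates outside \<open>V\<close> would otherwise contribute to
  them.
\<close>

definition vecs_on :: "'v set \<Rightarrow> (real ^ 'v) set" where
  "vecs_on V = {x. \<forall>i. i \<notin> V \<longrightarrow> x $ i = 0}"

definition mats_on :: "'v set \<Rightarrow> (real ^ 'v ^ 'v) set" where
  "mats_on V = {A. \<forall>i j. i \<notin> V \<or> j \<notin> V \<longrightarrow> A $ i $ j = 0}"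

definition ker_dim :: "'v::finite set \<Rightarrow> real ^ 'v ^ 'v \<Rightarrow> nat" where
  "ker_dim V A = dim {x \<in> vecs_on V. A *v x = 0}"

definition psd :: "real ^ 'v ^ 'v::finite \<Rightarrow> bool" where
  "psd A \<longleftrightarrow> transpose A = A \<and> (\<forall>x. 0 \<le> x \<bullet> (A *v x))"

definition outer :: "real ^ 'v \<Rightarrow> real ^ 'v ^ 'v::finite" where
  "outer u = (columnvector u :: real ^ 1 ^ 'v) ** (rowvector u :: real ^ 'v ^ 1)"

text \<open>
  The difference of the two standard basis vectors at the ends of an edge is determined only
  up to sign; the sign cancels in \<open>outer\<close>, see \<open>outer_edge_vec\<close>.
\<close>

definition edge_vec :: "('v::finite, 'e) mgraph \<Rightarrow> 'e \<Rightarrow> real ^ 'v" where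
  "edge_vec G e = (SOME u. \<exists>i j. ends G e = {i, j} \<and> u = axis i 1 - axis j 1)"

definition laplacian :: "('v::finite, 'e) mgraph \<Rightarrow> ('e \<Rightarrow> real) \<Rightarrow> real ^ 'v ^ 'v" where
  "laplacian G \<omega> = (\<Sum>e\<in>edges G. \<omega> e *\<^sub>R outer (edge_vec G e))"

lemma outer_edge_vec:
  assumes "ends G e = {i, j}"
  shows "outer (edge_vec G e) = outer (axis i 1 - axis j 1)"
proof -
  have "\<exists>i j. ends G e = {i, j} \<and> edge_vec G e = axis i 1 - axis j 1"
    unfolding edge_vec_def by (rule someI_ex) (use assms in blast)
  then obtain a b where ab: "ends G e = {a, b}" "edge_vec G e = axis a 1 - axis b 1"
    by blast
  have "a = i \<and> b = j \<or> a = j \<and> b = i"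
    using ab(1) assms by (auto simp: doubleton_eq_iff)
  then show ?thesis
    unfolding ab(2) outer_def columnvector_def rowvector_def matrix_matrix_mult_def
    by (auto simp: vec_eq_iff algebra_simps)
qed

text \<open>
  Since the dimension \<open>d\<close> is quantified over, a point of \<open>d\<close>-dimensional space is a function
  \<open>nat \<Rightarrow> real\<close> of which only the coordinates \<open>k < d\<close> matter; likewise a \<open>d\<close>-by-\<open>d\<close> matrix is
  a function \<open>nat \<Rightarrow> nat \<Rightarrow> real\<close> read at indices below \<open>d\<close>.
\<close>

definition affinely_spanning :: "'v set \<Rightarrow> nat \<Rightarrow> ('v \<Rightarrow> nat \<Rightarrow> real) \<Rightarrow> bool" where
  "affinely_spanning V d p \<longleftrightarrow>
     (\<forall>x::nat \<Rightarrow> real. \<exists>c::'v \<Rightarrow> real.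
        (\<Sum>i\<in>V. c i) = 1 \<and> (\<forall>k<d. x k = (\<Sum>i\<in>V. c i * p i k)))"

definition equilibrium_stress ::
    "('v, 'e) mgraph \<Rightarrow> nat \<Rightarrow> ('v \<Rightarrow> nat \<Rightarrow> real) \<Rightarrow> ('e \<Rightarrow> real) \<Rightarrow> bool" where
  "equilibrium_stress G d p \<omega> \<longleftrightarrow>
     (\<forall>i\<in>verts G. \<forall>k<d. (\<Sum>j\<in>verts G. \<Sum>e\<in>joining G i j. \<omega> e * (p j k - p i k)) = 0)"

definition strictly_proper ::
    "('v, 'e) mgraph \<Rightarrow> ('e \<Rightarrow> real) \<Rightarrow> ('e \<Rightarrow> real) \<Rightarrow> bool" where
  "strictly_proper G \<sigma> \<omega> \<longleftrightarrow> (\<forall>e\<in>edges G. \<sigma> e * \<omega> e > 0)"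

definition edges_on_conic :: "('v, 'e) mgraph \<Rightarrow> nat \<Rightarrow> ('v \<Rightarrow> nat \<Rightarrow> real) \<Rightarrow> bool" where
  "edges_on_conic G d p \<longleftrightarrow>
     (\<exists>S::nat \<Rightarrow> nat \<Rightarrow> real.
        (\<forall>a<d. \<forall>b<d. S a b = S b a) \<and> (\<exists>a<d. \<exists>b<d. S a b \<noteq> 0) \<and>
        (\<forall>(i, j)\<in>adj G.
           (\<Sum>a<d. \<Sum>b<d. (p j a - p i a) * S a b * (p j b - p i b)) = 0))"

definition super_stable ::
    "('v::finite, 'e) mgraph \<Rightarrow> nat \<Rightarrow> ('e \<Rightarrow> real) \<Rightarrow> ('v \<Rightarrow> nat \<Rightarrow> real) \<Rightarrow> bool" where
  "super_stable G d \<sigma> p \<longleftrightarrow>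
     (\<forall>e\<in>edges G. \<sigma> e \<in> {1, - 1}) \<and>
     affinely_spanning (verts G) d p \<and>
     (\<exists>\<omega>. equilibrium_stress G d p \<omega> \<and> strictly_proper G \<sigma> \<omega> \<and>
          psd (laplacian G \<omega>) \<and> ker_dim (verts G) (laplacian G \<omega>) = d + 1) \<and>
     \<not> edges_on_conic G d p"

definition lambda_connected :: "('v::finite, 'e) mgraph \<Rightarrow> nat" where
  "lambda_connected H = Max {d. \<exists>\<sigma> p. super_stable H d \<sigma> p}"

text \<open>A connected multigraph is its own only component, so this covers both cases.\<close>

definition lambda :: "('v::finite, 'e) mgraph \<Rightarrow> nat" where
  "lambda G = Max (lambda_connected ` conn_components G)"

definition cdv_matrices :: "('v::finite, 'e) mgraph \<Rightarrow> (real ^ 'v ^ 'v) set" where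
  "cdv_matrices G = {A \<in> mats_on (verts G). transpose A = A \<and>
     (\<forall>i\<in>verts G. \<forall>j\<in>verts G. i \<noteq> j \<longrightarrow>
        (card (joining G i j) = 0 \<longrightarrow> A $ i $ j = 0) \<and>
        (card (joining G i j) = 1 \<longrightarrow> A $ i $ j \<noteq> 0))}"

definition strong_arnold :: "('v::finite, 'e) mgraph \<Rightarrow> real ^ 'v ^ 'v \<Rightarrow> bool" where
  "strong_arnold G A \<longleftrightarrow>
     \<not> (\<exists>X\<in>mats_on (verts G). X \<noteq> 0 \<and> transpose X = X \<and> X ** A = 0 \<and>
          (\<forall>i\<in>verts G. \<forall>j\<in>verts G. i = j \<or> (i, j) \<in> adj G \<longrightarrow> X $ i $ j = 0))"

definition nu :: "('v::finite, 'e) mgraph \<Rightarrow> nat" where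
  "nu G = Max {ker_dim (verts G) A | A. A \<in> cdv_matrices G \<and> psd A \<and> strong_arnold G A}"

end

theory Submission imports Defs begin

text \<open>
  A super stable stress is, up to a positive definite block on the other components, a matrix in
  the class defining \<open>\<nu>\<close>: its kernel is spanned by the all-one vector and the coordinates
  of \<open>p\<close>, so a symmetric \<open>X\<close> with \<open>X A = 0\<close> is a quadratic form in the points, and the conic
  condition is the strong Arnold property.

  Conversely, let \<open>A\<close> attain \<open>\<nu>\<close>.  The strong Arnold property forces the kernel to live on one
  component.  If a kernel vector \<open>x\<close> vanishes at one end \<open>v\<close> of an edge \<open>uv\<close> but not at \<open>u\<close>, look for a
  perturbation \<open>C\<^sup>T A C\<close> with \<open>C\<close> near the identity, which has the same corank and is again
  positive semidefinite.  By the strong Arnold property the map sending \<open>C\<close> to the entries of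
  \<open>C\<^sup>T A C\<close> at non-edges and to the \<open>v\<close>-entry of \<open>C\<^sup>-\<^sup>1 x\<close> has a surjective derivative at the identity, so by
  an open mapping theorem the zero at \<open>v\<close> can be removed.  Repeating this yields a kernel vector
  without zeros on the component; scaling by it makes the all-one vector a kernel vector, so that
  the matrix is a weighted Laplacian and its kernel provides the points.
\<close>

section \<open>Perturbing a positive semidefinite matrix with the strong Arnold property\<close>

lemma bounded_bilinear_matrix_mult:
  "bounded_bilinear ((**) :: real^'n^'m \<Rightarrow> real^'k^'n \<Rightarrow> real^'k^'m)"
proof -
  have "bilinear ((**) :: real^'n^'m \<Rightarrow> real^'k^'n \<Rightarrow> real^'k^'m)"
    unfolding bilinear_def
    by (auto intro!: linearI simp: matrix_matrix_mult_def vec_eq_iff algebra_simps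
        sum.distrib sum_distrib_left)
  then show ?thesis
    by (simp add: bilinear_conv_bounded_bilinear)
qed

lemma bounded_bilinear_matrix_vector_mult:
  "bounded_bilinear ((*v) :: real^'n^'m \<Rightarrow> real^'n \<Rightarrow> real^'m)"
proof -
  have "bilinear ((*v) :: real^'n^'m \<Rightarrow> real^'n \<Rightarrow> real^'m)"
    unfolding bilinear_def
    by (auto intro!: linearI simp: matrix_vector_mult_def vec_eq_iff algebra_simps
        sum.distrib sum_distrib_left)
  then show ?thesis
    by (simp add: bilinear_conv_bounded_bilinear)
qed

lemma bounded_linear_transpose: "bounded_linear (transpose :: real^'n^'m \<Rightarrow> real^'m^'n)"
  by (auto intro!: linearI simp: transpose_def vec_eq_iff linear_conv_bounded_linear[symmetric])

text \<open>In finite dimension, injectivity on \<open>S\<close> gives a lower bound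
  \<open>e * norm x\<close> for the norm of \<open>h a x\<close>, and moving \<open>a\<close> by
  less than \<open>e / K\<close> cannot cancel it. This makes both invertibility and the strong
  Arnold property open conditions.\<close>

lemma eventually_injective_on_subspace:
  fixes h :: "'a::real_normed_vector \<Rightarrow> 'b::euclidean_space \<Rightarrow> 'c::euclidean_space"
  assumes h: "bounded_bilinear h" and S: "subspace S" and inj: "\<forall>x\<in>S. h a x = 0 \<longrightarrow> x = 0"
  shows "\<forall>\<^sub>F b in nhds a. \<forall>x\<in>S. h b x = 0 \<longrightarrow> x = 0"
proof -
  interpret h: bounded_bilinear h by fact
  obtain e where e: "e > 0" "\<forall>x\<in>S. norm (h a x) \<ge> e * norm x"
    using injective_imp_isometric[OF closed_subspace[OF S] S h.bounded_linear_right inj] by blast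
  obtain K where K: "K > 0" "\<And>a b. norm (h a b) \<le> norm a * norm b * K"
    using h.pos_bounded by blast
  have "x = 0" if d: "dist b a < e / K" and x: "x \<in> S" and 0: "h b x = 0" for b x
  proof (rule ccontr)
    assume "x \<noteq> 0"
    have "e * norm x \<le> norm (h (b - a) x)"
      using e x 0 by (simp add: h.diff_left)
    also have "\<dots> \<le> dist b a * K * norm x"
      using K(2)[of "b - a" x] by (simp add: dist_norm mult_ac)
    also have "\<dots> < e * norm x"
      using d K(1) \<open>x \<noteq> 0\<close>
      by (intro mult_strict_right_mono) (simp_all add: pos_less_divide_eq)
    finally show False by simp
  qed
  then show ?thesis
    unfolding eventually_nhds_metric using e K by (intro exI[of _ "e / K"]) auto
qed

section \<open>Edge patterns, the strong Arnold property and semidefinite kernels\<close>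

definition supported :: "('v \<times> 'v) set \<Rightarrow> (real^'v^'v) set" where
  "supported E = {A. \<forall>i j. i \<noteq> j \<longrightarrow> (i, j) \<notin> E \<longrightarrow> A $ i $ j = 0}"

text \<open>These are the symmetric matrices orthogonal to \<open>supported E\<close>, that is, the
  candidates for a violation of the strong Arnold property.\<close>

definition hidden :: "('v \<times> 'v) set \<Rightarrow> (real^'v^'v) set" where
  "hidden E = {X. transpose X = X \<and> (\<forall>i j. i = j \<or> (i, j) \<in> E \<longrightarrow> X $ i $ j = 0)}"

text \<open>The strong Arnold property over all indices of the type, phrased as injectivity of a
  linear map on a fixed subspace so that it is visibly stable under small changes of
  \<open>A\<close>.\<close>

definition sap :: "('v \<times> 'v) set \<Rightarrow> real^'v^'v::finite \<Rightarrow> bool" where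
  "sap E A \<longleftrightarrow> (\<forall>X\<in>hidden E. X ** A = 0 \<longrightarrow> X = 0)"

lemma sym_entry: "transpose A = A \<Longrightarrow> A $ i $ j = A $ j $ i"
  by (metis transpose_def vec_lambda_beta)

lemma subspace_hidden: "subspace (hidden E)"
  by (auto simp: subspace_def hidden_def transpose_def vec_eq_iff)

lemma psd_sym: "psd A \<Longrightarrow> transpose A = A"
  by (simp add: psd_def)

lemma inner_sym_matrix:
  fixes A :: "real^'n^'n"
  shows "transpose A = A \<Longrightarrow> x \<bullet> (A *v y) = (A *v x) \<bullet> y"
  by (metis dot_lmul_matrix transpose_matrix_vector)

text \<open>If \<open>A *v x\<close> were nonzero, moving from \<open>x\<close> a little way against
  \<open>A *v x\<close> would make the quadratic form negative: it has no constant term and a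
  negative linear one.\<close>

lemma psd_kernel:
  assumes "psd A" "x \<bullet> (A *v x) = 0"
  shows "A *v x = 0"
proof (rule ccontr)
  let ?y = "A *v x"
  assume "?y \<noteq> 0"
  define b where "b = ?y \<bullet> ?y"
  define c where "c = ?y \<bullet> (A *v ?y)"
  have b: "b > 0" using \<open>?y \<noteq> 0\<close> by (simp add: b_def)
  have c: "c \<ge> 0" using assms by (simp add: c_def psd_def)
  have ineq: "0 \<le> - 2 * t * b + t\<^sup>2 * c" for t
  proof -
    have "0 \<le> (x - t *\<^sub>R ?y) \<bullet> (A *v (x - t *\<^sub>R ?y))"
      using assms by (simp add: psd_def)
    also have "\<dots> = - 2 * t * b + t\<^sup>2 * c"
      using assms inner_sym_matrix[OF psd_sym[OF assms(1)], of x ?y]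
      by (simp add: matrix_vector_mult_diff_distrib matrix_vector_mult_scaleR inner_diff_left
          inner_diff_right b_def c_def power2_eq_square algebra_simps)
    finally show ?thesis .
  qed
  \<comment> \<open>The added 1 keeps the denominator positive when \<open>c = 0\<close>;
    substituting \<open>b = t * (c + 1)\<close> leaves a negative multiple of the square of
    \<open>t\<close>.\<close>
  define t where "t = b / (c + 1)"
  have bt: "b = t * (c + 1)" and t: "t > 0"
    using b c by (simp_all add: t_def)
  have "0 \<le> - 2 * t * b + t\<^sup>2 * c"
    by (rule ineq)
  also have "\<dots> = t\<^sup>2 * (c - 2 * (c + 1))"
    by (simp add: bt power2_eq_square algebra_simps)
  also have "\<dots> < 0"
    using t c by (intro mult_pos_neg) auto
  finally show False by simp
qed

lemma inner_transpose:
  fixes X Y :: "real^'n^'m"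
  shows "transpose X \<bullet> transpose Y = X \<bullet> Y"
  unfolding inner_vec_def transpose_def by simp (rule sum.swap)

text \<open>The rank-one product of \<open>w\<close> with the transposed basis vector at
  \<open>u\<close>. Used as a test direction, it isolates one row of a symmetric matrix.\<close>

definition column_matrix :: "'n \<Rightarrow> real^'m \<Rightarrow> real^'n^'m" where
  "column_matrix u w = (\<chi> i j. if j = u then w $ i else 0)"

lemma inner_column_matrix: "X \<bullet> column_matrix u w = transpose X $ u \<bullet> w"
  by (simp add: inner_vec_def column_matrix_def transpose_def if_distrib cong: if_cong)

lemma matrix_mult_column_matrix: "A ** column_matrix u w = column_matrix u (A *v w)"
  by (simp add: vec_eq_iff matrix_matrix_mult_def matrix_vector_mult_def column_matrix_def)

lemma column_matrix_vector_mult: "column_matrix u w *v x = x $ u *\<^sub>R w"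
proof -
  have "(\<Sum>j\<in>UNIV. (if j = u then w $ i else 0) * x $ j) = x $ u * w $ i" for i
    by (subst sum.cong[OF refl, of _ _ "\<lambda>j. if j = u then x $ u * w $ i else 0"]) auto
  then show ?thesis
    by (simp add: vec_eq_iff matrix_vector_mult_def column_matrix_def)
qed

text \<open>By symmetry of \<open>A\<close>, row \<open>u\<close> of \<open>X ** A\<close> is
  \<open>A\<close> applied to row \<open>u\<close> of \<open>X\<close>. The strong Arnold property
  thereby speaks of matrices whose rows are kernel vectors.\<close>

lemma sym_mult_eq_0_iff:
  fixes A X :: "real^'n^'n"
  assumes "transpose A = A" "transpose X = X"
  shows "X ** A = 0 \<longleftrightarrow> (\<forall>u. A *v (X $ u) = 0)"
proof -
  have "(X ** A) $ u $ i = (A *v (X $ u)) $ i" for u i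
    unfolding matrix_matrix_mult_def matrix_vector_mult_def vec_lambda_beta
    by (rule sum.cong[OF refl]) (subst sym_entry[OF assms(1)], rule mult.commute)
  then have "(X ** A) $ u = A *v (X $ u)" for u
    by (simp add: vec_eq_iff)
  then show ?thesis by (simp add: vec_eq_iff[of "X ** A"])
qed

text \<open>For symmetric \<open>E\<close> this is the orthogonal projection onto
  \<open>hidden E\<close>.\<close>

definition hidden_part :: "('v \<times> 'v) set \<Rightarrow> real^'v^'v \<Rightarrow> real^'v^'v::finite" where
  "hidden_part E W = (\<chi> i j. if i = j \<or> (i, j) \<in> E then 0 else (W $ i $ j + W $ j $ i) / 2)"

lemma bounded_linear_hidden_part: "bounded_linear (hidden_part E)"
  unfolding linear_conv_bounded_linear[symmetric]
  by (rule linearI) (auto simp: hidden_part_def vec_eq_iff field_simps)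

text \<open>Elementary matrices at diagonal or edge positions and differences of an elementary
  matrix and its transpose have zero hidden part; testing against them gives the zero entries and
  the symmetry of \<open>X\<close>.\<close>

lemma orthogonal_complement_hidden:
  assumes "sym E" and orth: "\<And>Y. X \<bullet> (Y - hidden_part E Y) = 0"
  shows "X \<in> hidden E"
proof -
  let ?e = "\<lambda>i j. axis i (axis j 1) :: real^'a^'a"
  have e: "X \<bullet> ?e i j = X $ i $ j" for i j
    by (simp add: inner_axis)
  have "X $ i $ j = 0" if "i = j \<or> (i, j) \<in> E" for i j
  proof -
    have "hidden_part E (?e i j) = 0"
      using that \<open>sym E\<close> by (auto simp: hidden_part_def vec_eq_iff axis_def sym_def)
    then show ?thesis using orth[of "?e i j"] e by simp
  qed
  moreover have "X $ i $ j = X $ j $ i" for i j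
  proof -
    have "hidden_part E (?e i j - ?e j i) = 0"
      by (auto simp: hidden_part_def vec_eq_iff axis_def)
    then show ?thesis using orth[of "?e i j - ?e j i"] e by (simp add: inner_diff_right)
  qed
  ultimately show ?thesis
    by (auto simp: hidden_def vec_eq_iff transpose_def)
qed

lemma linear_surj_if_no_orthogonal:
  fixes f :: "'a::euclidean_space \<Rightarrow> 'b::euclidean_space"
  assumes "linear f" and "\<And>z. (\<And>x. z \<bullet> f x = 0) \<Longrightarrow> z = 0"
  shows "surj f"
proof (rule ccontr)
  assume "\<not> surj f"
  moreover have "span (range f) = range f"
    by (simp add: assms(1) linear_subspace_image)
  ultimately have "span (range f) \<subset> span UNIV" by (metis span_UNIV top.not_eq_extremum)
  then obtain z where "z \<noteq> 0" "\<And>y. y \<in> span (range f) \<Longrightarrow> orthogonal z y"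
    by (rule orthogonal_to_subspace_exists_gen) blast
  then show False
    using assms(2)[of z] by (auto simp: orthogonal_def span_base)
qed

text \<open>Surjectivity of a derivative lets the entry at \<open>v\<close> be moved off zero while
  the zero entries at non-edges and the equation \<open>C *v y = x\<close> are kept. The predicate
  \<open>P\<close> carries whatever open conditions have to survive.\<close>

lemma perturbation:
  fixes A :: "real^'v^'v"
  assumes A: "psd A" "A \<in> supported E" "sap E A" and E: "sym E"
    and x: "A *v x = 0" "x $ u \<noteq> 0" "x $ v = 0" and uv: "(u, v) \<in> E"
    and P: "eventually P (nhds (mat 1, x))"
  shows "\<exists>C y. P (C, y) \<and> transpose C ** A ** C \<in> supported E \<and> C *v y = x \<and> y $ v \<noteq> 0"
proof -
  note symA = psd_sym[OF A(1)]
  interpret mm: bounded_bilinear "(**) :: real^'v^'v \<Rightarrow> real^'v^'v \<Rightarrow> real^'v^'v"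
    by (rule bounded_bilinear_matrix_mult)
  interpret mv: bounded_bilinear "(*v) :: real^'v^'v \<Rightarrow> real^'v \<Rightarrow> real^'v"
    by (rule bounded_bilinear_matrix_vector_mult)
  interpret tr: bounded_linear "transpose :: real^'v^'v \<Rightarrow> real^'v^'v"
    by (rule bounded_linear_transpose)
  interpret hp: bounded_linear "hidden_part E :: real^'v^'v \<Rightarrow> _"
    by (rule bounded_linear_hidden_part)
  \<comment> \<open>The slack variable \<open>W\<close> turns the condition that the hidden entries of \<open>C\<^sup>T A C\<close> vanish into an
    equation in the full matrix space, as the open mapping theorem requires.\<close>
  define f :: "(real^'v^'v) \<times> (real^'v) \<times> (real^'v^'v) \<Rightarrow> (real^'v^'v) \<times> (real^'v) \<times> real" where
    "f = (\<lambda>(C, y, W). (transpose C ** A ** C - (W - hidden_part E W), C *v y, y $ v))"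
  define f' :: "(real^'v^'v) \<times> (real^'v) \<times> (real^'v^'v) \<Rightarrow> (real^'v^'v) \<times> (real^'v) \<times> real" where
    "f' = (\<lambda>(N, z, Y). (transpose N ** A + A ** N - (Y - hidden_part E Y), N *v x + z, z $ v))"
  define p :: "(real^'v^'v) \<times> (real^'v) \<times> (real^'v^'v)" where "p = (mat 1, x, A)"
  have nth: "bounded_linear (\<lambda>y :: real^'v. y $ v)"
    by (rule bounded_linear_vec_nth)
  have der: "(f has_derivative f') (at p)"
  proof -
    have C: "(fst has_derivative fst) (at p)"
      and y: "((\<lambda>q. fst (snd q)) has_derivative (\<lambda>q. fst (snd q))) (at p)"
      and W: "((\<lambda>q. snd (snd q)) has_derivative (\<lambda>q. snd (snd q))) (at p)"
      by (auto intro!: derivative_eq_intros)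
    note M = mm.FDERIV[OF mm.FDERIV[OF tr.has_derivative[OF C] has_derivative_const[of A]] C]
    note S = has_derivative_diff[OF M has_derivative_diff[OF W hp.has_derivative[OF W]]]
    note D = has_derivative_Pair[OF S has_derivative_Pair[OF mv.FDERIV[OF C y]
          bounded_linear.has_derivative[OF nth y]]]
    show ?thesis
      unfolding f_def f'_def case_prod_beta
      by (rule has_derivative_eq_rhs[OF D])
        (auto simp: p_def fun_eq_iff mm.zero_right transpose_mat add_ac)
  qed
  have lin': "linear f'"
    using der by (rule has_derivative_linear)
  have "surj f'"
  proof (rule linear_surj_if_no_orthogonal[OF lin'])
    fix t :: "(real^'v^'v) \<times> (real^'v) \<times> real"
    assume orth: "\<And>q. t \<bullet> f' q = 0"
    obtain X a s where t: "t = (X, a, s)" by (cases t) auto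
    have "X \<bullet> (Y - hidden_part E Y) = 0" for Y
      using orth[of "(0, 0, Y)"]
      by (simp add: t f'_def tr.zero mm.zero_left mm.zero_right inner_diff_right)
    then have X: "X \<in> hidden E" by (rule orthogonal_complement_hidden[OF E])
    then have symX: "transpose X = X" by (simp add: hidden_def)
    have N: "X \<bullet> (transpose N ** A + A ** N) + a \<bullet> (N *v x) = 0" for N
      using orth[of "(N, 0, 0)"] by (simp add: t f'_def hp.zero)
    \<comment> \<open>Take the variation \<open>N = column_matrix k w\<close>. The two terms
      containing \<open>A\<close> are transposes of each other, so the symmetric \<open>X\<close>
      gives them equal weight; hence the factor 2.\<close>
    have 1: "2 * (X $ k \<bullet> (A *v w)) + x $ k * (a \<bullet> w) = 0" for k w
    proof -
      have "transpose (column_matrix k w) ** A = transpose (A ** column_matrix k w)"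
        by (simp add: matrix_transpose_mul symA)
      then have "X \<bullet> (transpose (column_matrix k w) ** A) = X \<bullet> (A ** column_matrix k w)"
        using inner_transpose symX by metis
      then show ?thesis
        using N[of "column_matrix k w"]
        by (simp add: inner_add_right matrix_mult_column_matrix inner_column_matrix symX
            column_matrix_vector_mult)
    qed
    \<comment> \<open>Variations of \<open>y\<close> alone tie the multiplier \<open>a\<close> to
      the entry at \<open>v\<close>.\<close>
    have "a + s *\<^sub>R axis v 1 = 0"
    proof -
      have "(a + s *\<^sub>R axis v 1) \<bullet> z = 0" for z
        using orth[of "(0, z, 0)"]
        by (simp add: t f'_def tr.zero mm.zero_left mm.zero_right hp.zero inner_add_left inner_axis')
      then show ?thesis by (metis inner_eq_zero_iff)
    qed
    then have a: "a = - s *\<^sub>R axis v 1"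
      by (simp add: eq_neg_iff_add_eq_0)
    have aw: "a \<bullet> w = - s * w $ v" for w
      by (simp add: a inner_axis')
    \<comment> \<open>Since \<open>uv\<close> is an edge, \<open>X\<close> vanishes at \<open>uv\<close>, so row \<open>u\<close> of \<open>X\<close> is isotropic for \<open>A\<close>.\<close>
    have "X $ u $ v = 0" using X uv by (auto simp: hidden_def)
    then have "X $ u \<bullet> (A *v X $ u) = 0"
      using 1[of u "X $ u"] by (simp add: aw)
    then have "A *v X $ u = 0" by (rule psd_kernel[OF A(1)])
    \<comment> \<open>Since \<open>A\<close> kills row \<open>u\<close> of \<open>X\<close>, testing
      with the basis vector at \<open>v\<close> leaves only the term with \<open>s\<close>.\<close>
    then have "x $ u * s = 0"
      using 1[of u "axis v 1"] by (simp add: aw inner_sym_matrix[OF symA])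
    then have s: "s = 0" using x by simp
    have "(A *v X $ k) \<bullet> w = 0" for k w
      using 1[of k w] by (simp add: aw s inner_sym_matrix[OF symA])
    then have "A *v X $ k = 0" for k by (metis inner_eq_zero_iff)
    then have "X = 0"
      using A(3) X by (auto simp: sap_def sym_mult_eq_0_iff[OF symA symX])
    then show "t = 0" by (simp add: t s a zero_prod_def)
  qed
  then obtain g where g: "linear g" "f' \<circ> g = id"
    using linear_surjective_right_inverse[OF lin'] by blast
  have contf: "continuous_on UNIV f"
    unfolding f_def case_prod_beta
    by (intro continuous_intros mm.continuous_on mv.continuous_on tr.continuous_on
        hp.continuous_on bounded_linear.continuous_on[OF nth])
  obtain T0 where T0: "open T0" "(mat 1, x) \<in> T0" "\<And>q. q \<in> T0 \<Longrightarrow> P q"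
    using P unfolding eventually_nhds by blast
  define T where "T = (\<lambda>(C, y, W). (C, y)) -` T0 \<inter> (UNIV :: ((real^'v^'v) \<times> (real^'v) \<times> (real^'v^'v)) set)"
  have "open T"
    unfolding T_def case_prod_beta by (intro open_vimage T0 continuous_intros open_Int) auto
  then have "p \<in> interior T"
    using T0 by (simp add: interior_open T_def p_def)
  \<comment> \<open>A continuous map whose derivative at a point has a right inverse sends
    neighbourhoods of that point to neighbourhoods of its value.\<close>
  from sussmann_open_mapping[OF open_UNIV contf _ der _ g(2) _ this]
  have "f p \<in> interior (f ` T)"
    using g(1) by (auto simp: linear_conv_bounded_linear)
  moreover have "f p = (0, x, 0)"
  proof -
    have "hidden_part E A = 0"
      using A(2) sym_entry[OF symA] by (auto simp: hidden_part_def supported_def vec_eq_iff)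
    then show ?thesis using x by (simp add: f_def p_def transpose_mat)
  qed
  ultimately obtain e where e: "e > 0" "ball (0, x, 0) e \<subseteq> f ` T"
    by (metis mem_interior)
  \<comment> \<open>The target differs from \<open>f p\<close> only in the last coordinate, which
    becomes the new nonzero entry at \<open>v\<close>.\<close>
  have "(0, x, e / 2) \<in> ball (0, x, 0 :: real) e"
    using e by (simp add: dist_prod_def)
  then have "(0, x, e / 2) \<in> f ` T"
    using e by blast
  then obtain C y W where CyW: "(C, y, W) \<in> T" "(0, x, e / 2) = f (C, y, W)"
    by (elim imageE) (metis prod_cases3)
  let ?M = "transpose C ** A ** C"
  have M: "?M = W - hidden_part E W" and "C *v y = x" "y $ v \<noteq> 0"
    using CyW e by (auto simp: f_def)
  have "transpose ?M = ?M"
    by (simp add: matrix_transpose_mul symA matrix_mul_assoc)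
  then have symM: "?M $ i $ j = ?M $ j $ i" for i j
    by (rule sym_entry)
  \<comment> \<open>At a non-edge, \<open>W - hidden_part E W\<close> retains only the antisymmetric
    part of \<open>W\<close>, whereas \<open>?M\<close> is symmetric.\<close>
  have "?M $ i $ j = 0" if "i \<noteq> j" "(i, j) \<notin> E" for i j
  proof -
    have "(j, i) \<notin> E" using that E by (auto simp: sym_def)
    then have "?M $ i $ j = - ?M $ j $ i"
      using that unfolding M by (simp add: hidden_part_def field_simps)
    then show ?thesis using symM[of i j] by simp
  qed
  then have "?M \<in> supported E" by (simp add: supported_def)
  then show ?thesis
    using CyW \<open>C *v y = x\<close> \<open>y $ v \<noteq> 0\<close> T0(3) by (auto simp: T_def)
qed

section \<open>Kernel vectors without zeros on a component\<close>

text \<open>\<open>E\<close> holds the adjacent pairs and \<open>F\<close> those whose entries must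
  not vanish, later the pairs joined by exactly one edge.\<close>

definition arnold :: "('v \<times> 'v) set \<Rightarrow> ('v \<times> 'v) set \<Rightarrow> real^'v^'v::finite \<Rightarrow> bool" where
  "arnold E F A \<longleftrightarrow>
     psd A \<and> A \<in> supported E \<and> (\<forall>i j. (i, j) \<in> F \<longrightarrow> A $ i $ j \<noteq> 0) \<and> sap E A"

abbreviation null_space :: "real^'n^'m \<Rightarrow> (real^'n) set" where
  "null_space A \<equiv> {x. A *v x = 0}"

section \<open>Congruence transformations and removal of zeros\<close>

lemma inner_transpose_mult:
  fixes C :: "real^'n^'m"
  shows "x \<bullet> (transpose C *v w) = (C *v x) \<bullet> w"
  using dot_lmul_matrix[of w C x] by (simp add: transpose_matrix_vector inner_commute)

lemma psd_congruence:
  fixes A C :: "real^'n^'n"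
  assumes "psd A"
  shows "psd (transpose C ** A ** C)"
proof -
  have "x \<bullet> ((transpose C ** A ** C) *v x) = (C *v x) \<bullet> (A *v (C *v x))" for x
    unfolding inner_transpose_mult[symmetric]
    by (simp add: matrix_vector_mul_assoc matrix_mul_assoc)
  then show ?thesis
    using assms by (simp add: psd_def matrix_transpose_mul matrix_mul_assoc)
qed

text \<open>The kernel of the congruent matrix is the preimage of the kernel of \<open>A\<close>
  under the bijection given by \<open>C\<close>.\<close>

lemma dim_null_space_congruence:
  fixes A C :: "real^'n^'n"
  assumes "psd A" and inj: "\<And>x. C *v x = 0 \<Longrightarrow> x = 0"
  shows "dim (null_space (transpose C ** A ** C)) = dim (null_space A)"
proof -
  have "linear ((*v) C)" by simp
  have "inj ((*v) C)"
    using inj by (simp add: linear_injective_0)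
  then have surj: "surj ((*v) C)"
    by (rule linear_injective_imp_surjective[OF \<open>linear ((*v) C)\<close>]) simp
  have mult: "(transpose C ** A ** C) *v y = transpose C *v (A *v (C *v y))" for y
    by (simp add: matrix_vector_mul_assoc[symmetric] matrix_mul_assoc[symmetric])
  have "A *v (C *v y) = 0" if "(transpose C ** A ** C) *v y = 0" for y
  proof (rule psd_kernel[OF assms(1)])
    show "(C *v y) \<bullet> (A *v (C *v y)) = 0"
      using that unfolding mult inner_transpose_mult[symmetric] by simp
  qed
  then have "null_space (transpose C ** A ** C) = (*v) C -` null_space A"
    using mult by auto
  then have "(*v) C ` null_space (transpose C ** A ** C) = null_space A"
    by (simp only: surj_image_vimage_eq[OF surj])
  then show ?thesis
    using dim_image_eq[OF \<open>linear ((*v) C)\<close>, of "null_space (transpose C ** A ** C)"]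
      \<open>inj ((*v) C)\<close> by (metis inj_on_subset top_greatest)
qed

text \<open>Nonzero entries at \<open>F\<close>, nonzero coordinates of the kernel vector, the
  strong Arnold property and invertibility of \<open>C\<close> all persist near
  \<open>(mat 1, x)\<close>. Together they serve as the predicate \<open>P\<close> of
  \<open>perturbation\<close>.\<close>

lemma arnold_perturbation:
  fixes A :: "real^'v^'v"
  assumes A: "arnold E F A" and E: "sym E"
    and x: "A *v x = 0" "x $ u \<noteq> 0" "x $ v = 0" and uv: "(u, v) \<in> E"
  shows "\<exists>A' y. arnold E F A' \<and> A' *v y = 0 \<and> dim (null_space A') = dim (null_space A) \<and>
           (\<forall>i. x $ i \<noteq> 0 \<longrightarrow> y $ i \<noteq> 0) \<and> y $ v \<noteq> 0"
proof -
  interpret mm: bounded_bilinear "(**) :: real^'v^'v \<Rightarrow> real^'v^'v \<Rightarrow> real^'v^'v"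
    by (rule bounded_bilinear_matrix_mult)
  interpret mv: bounded_bilinear "(*v) :: real^'v^'v \<Rightarrow> real^'v \<Rightarrow> real^'v"
    by (rule bounded_bilinear_matrix_vector_mult)
  interpret tr: bounded_linear "transpose :: real^'v^'v \<Rightarrow> real^'v^'v"
    by (rule bounded_linear_transpose)
  let ?M = "\<lambda>C. transpose C ** A ** C"
  let ?N = "nhds (mat 1 :: real^'v^'v, x)"
  have C: "(fst \<longlongrightarrow> mat 1) ?N" and y: "(snd \<longlongrightarrow> x) ?N"
    using tendsto_fst[OF filterlim_ident[of ?N]] tendsto_snd[OF filterlim_ident[of ?N]] by simp_all
  have M: "((\<lambda>q. ?M (fst q)) \<longlongrightarrow> A) ?N"
    using mm.tendsto[OF mm.tendsto[OF tr.tendsto[OF C] tendsto_const[of A]] C]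
    by (simp add: transpose_mat)
  have "\<forall>\<^sub>F q in ?N. \<forall>i. \<forall>j. (i, j) \<in> F \<longrightarrow> ?M (fst q) $ i $ j \<noteq> 0"
  proof (intro eventually_all_finite)
    fix i j
    show "\<forall>\<^sub>F q in ?N. (i, j) \<in> F \<longrightarrow> ?M (fst q) $ i $ j \<noteq> 0"
    proof (cases "(i, j) \<in> F")
      case True
      then have "A $ i $ j \<noteq> 0" using A by (simp add: arnold_def)
      then show ?thesis
        using tendsto_imp_eventually_ne[OF tendsto_vec_nth[OF tendsto_vec_nth[OF M]]] True by simp
    qed simp
  qed
  moreover have "\<forall>\<^sub>F q in ?N. \<forall>i. x $ i \<noteq> 0 \<longrightarrow> snd q $ i \<noteq> 0"
  proof (intro eventually_all_finite)
    fix i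
    show "\<forall>\<^sub>F q in ?N. x $ i \<noteq> 0 \<longrightarrow> snd q $ i \<noteq> 0"
    proof (cases "x $ i = 0")
      case False
      then show ?thesis
        using tendsto_imp_eventually_ne[OF tendsto_vec_nth[OF y]] by simp
    qed simp
  qed
  moreover have "\<forall>\<^sub>F q in ?N. \<forall>X\<in>hidden E. X ** ?M (fst q) = 0 \<longrightarrow> X = 0"
  proof (rule eventually_compose_filterlim[OF _ M])
    show "\<forall>\<^sub>F B in nhds A. \<forall>X\<in>hidden E. X ** B = 0 \<longrightarrow> X = 0"
      using A by (intro eventually_injective_on_subspace[OF mm.flip subspace_hidden])
        (simp add: arnold_def sap_def)
  qed
  moreover have "\<forall>\<^sub>F q in ?N. \<forall>z\<in>UNIV. fst q *v z = 0 \<longrightarrow> z = 0"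
    by (rule eventually_compose_filterlim[OF _ C],
        rule eventually_injective_on_subspace[OF bounded_bilinear_matrix_vector_mult]) auto
  ultimately have P: "\<forall>\<^sub>F q in ?N. (\<forall>i. \<forall>j. (i, j) \<in> F \<longrightarrow> ?M (fst q) $ i $ j \<noteq> 0) \<and>
      (\<forall>i. x $ i \<noteq> 0 \<longrightarrow> snd q $ i \<noteq> 0) \<and>
      (\<forall>X\<in>hidden E. X ** ?M (fst q) = 0 \<longrightarrow> X = 0) \<and> (\<forall>z\<in>UNIV. fst q *v z = 0 \<longrightarrow> z = 0)"
    by (intro eventually_conj)
  have A': "psd A" "A \<in> supported E" "sap E A"
    using A by (auto simp: arnold_def)
  obtain C y where Cy: "\<forall>i. \<forall>j. (i, j) \<in> F \<longrightarrow> ?M C $ i $ j \<noteq> 0"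
      "\<forall>i. x $ i \<noteq> 0 \<longrightarrow> y $ i \<noteq> 0" "\<forall>X\<in>hidden E. X ** ?M C = 0 \<longrightarrow> X = 0"
      "\<forall>z. C *v z = 0 \<longrightarrow> z = 0" "?M C \<in> supported E" "C *v y = x" "y $ v \<noteq> 0"
    using perturbation[OF A' E x uv P] by auto
  show ?thesis
  proof (intro exI conjI)
    show "arnold E F (?M C)"
      using Cy by (simp add: arnold_def sap_def psd_congruence[OF A'(1)])
    show "?M C *v y = 0"
      using Cy x by (simp add: matrix_vector_mul_assoc[symmetric] matrix_mul_assoc[symmetric])
    show "dim (null_space (?M C)) = dim (null_space A)"
      using Cy by (intro dim_null_space_congruence[OF A'(1)]) auto
  qed (use Cy in auto)
qed

lemma rtrancl_exit:
  assumes "(u, w) \<in> E\<^sup>*" "P u" "\<not> P w"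
  shows "\<exists>a b. (u, b) \<in> E\<^sup>* \<and> (a, b) \<in> E \<and> P a \<and> \<not> P b"
  using assms
proof (induction rule: rtrancl_induct)
  case (step a b)
  then show ?case by (meson rtrancl_into_rtrancl)
qed auto

text \<open>Induction on the number of zeros in the component of \<open>u\<close>: while one exists,
  some edge leads from a nonzero coordinate to a zero one, and a perturbation removes that zero
  without creating another.\<close>

lemma arnold_full_kernel_vector:
  fixes A :: "real^'v^'v"
  assumes "arnold E F A" "sym E" "A *v x = 0" "x $ u \<noteq> 0"
  shows "\<exists>A' y. arnold E F A' \<and> A' *v y = 0 \<and> dim (null_space A') = dim (null_space A) \<and>
           (\<forall>i. (u, i) \<in> E\<^sup>* \<longrightarrow> y $ i \<noteq> 0)"
  using assms
proof (induction "card {i. (u, i) \<in> E\<^sup>* \<and> x $ i = 0}" arbitrary: A x rule: less_induct)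
  case less
  show ?case
  proof (cases "\<forall>i. (u, i) \<in> E\<^sup>* \<longrightarrow> x $ i \<noteq> 0")
    case True
    then show ?thesis using less.prems by blast
  next
    case False
    then obtain a b where ab: "(u, b) \<in> E\<^sup>*" "(a, b) \<in> E" "x $ a \<noteq> 0" "x $ b = 0"
      using rtrancl_exit[of u _ E "\<lambda>i. x $ i \<noteq> 0"] less.prems by blast
    then obtain A' y where A': "arnold E F A'" "A' *v y = 0"
        "dim (null_space A') = dim (null_space A)" "\<forall>i. x $ i \<noteq> 0 \<longrightarrow> y $ i \<noteq> 0" "y $ b \<noteq> 0"
      using arnold_perturbation[OF less.prems(1-3) ab(3,4,2)] by blast
    then have "{i. (u, i) \<in> E\<^sup>* \<and> y $ i = 0} \<subset> {i. (u, i) \<in> E\<^sup>* \<and> x $ i = 0}"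
      using ab by blast
    then have "card {i. (u, i) \<in> E\<^sup>* \<and> y $ i = 0} < card {i. (u, i) \<in> E\<^sup>* \<and> x $ i = 0}"
      by (intro psubset_card_mono) auto
    from less.hyps[OF this A'(1) less.prems(2) A'(2)] A'(3,4) less.prems(4) show ?thesis
      by metis
  qed
qed

section \<open>Restriction to unions of components and the normal form\<close>

definition restrict_vec :: "'n set \<Rightarrow> real^'n \<Rightarrow> real^'n" where
  "restrict_vec S x = (\<chi> i. if i \<in> S then x $ i else 0)"

lemma restrict_vec_nth [simp]: "restrict_vec S x $ i = (if i \<in> S then x $ i else 0)"
  by (simp add: restrict_vec_def)

definition coord_proj :: "'n set \<Rightarrow> real^'n^'n" where
  "coord_proj S = (\<chi> i j. if i = j \<and> i \<in> S then 1 else 0)"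

lemma coord_proj_nth [simp]: "coord_proj S $ i $ j = (if i = j \<and> i \<in> S then 1 else 0)"
  by (simp add: coord_proj_def)

lemma coord_proj_mult: "coord_proj S *v x = restrict_vec S x"
proof -
  have "(\<Sum>j\<in>UNIV. (if i = j \<and> i \<in> S then 1 else 0) * x $ j) =
      (\<Sum>j\<in>UNIV. if j = i then (if i \<in> S then x $ i else 0) else 0)" for i
    by (rule sum.cong) auto
  then show ?thesis by (simp add: matrix_vector_mult_def vec_eq_iff)
qed

lemma inner_restrict_vec_self: "x \<bullet> restrict_vec S x = (\<Sum>i\<in>S. (x $ i)\<^sup>2)"
  unfolding inner_vec_def
  by (rule sum.mono_neutral_cong_right) (auto simp: power2_eq_square)

text \<open>No edge leaves \<open>S\<close>, so \<open>A\<close> is block diagonal with respect to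
  \<open>S\<close> and its complement.\<close>

lemma mult_restrict_vec:
  fixes A :: "real^'n^'n"
  assumes "A \<in> supported E" and "\<And>i j. (i, j) \<in> E \<Longrightarrow> i \<in> S \<longleftrightarrow> j \<in> S"
  shows "A *v restrict_vec S x = restrict_vec S (A *v x)"
proof -
  have 0: "A $ i $ j = 0" if "(i \<in> S) \<noteq> (j \<in> S)" for i j
  proof -
    have "(i, j) \<notin> E" using assms(2)[of i j] that by auto
    moreover have "i \<noteq> j" using that by auto
    ultimately show ?thesis using assms(1) by (simp add: supported_def)
  qed
  have "(\<Sum>j\<in>UNIV. A $ i $ j * (if j \<in> S then x $ j else 0)) =
      (if i \<in> S then (\<Sum>j\<in>UNIV. A $ i $ j * x $ j) else 0)" for i
    using 0[of i] by (auto intro!: sum.cong sum.neutral)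
  then show ?thesis
    by (simp add: vec_eq_iff matrix_vector_mult_def)
qed

text \<open>If \<open>x\<close> and \<open>y\<close> are kernel vectors with supports in different components, then the matrix
  \<open>x y\<^sup>T + y x\<^sup>T\<close> contradicts the strong Arnold property.\<close>
lemma kernel_in_one_component:
  fixes A :: "real^'v^'v"
  assumes A: "arnold E F A" and E: "sym E" and x: "A *v x = 0" "x $ u \<noteq> 0"
    and y: "A *v y = 0" and i: "(u, i) \<notin> E\<^sup>*"
  shows "y $ i = 0"
proof -
  define S where "S = {i. (u, i) \<in> E\<^sup>*}"
  have S: "i \<in> S \<longleftrightarrow> j \<in> S" if "(i, j) \<in> E" for i j
    using that E unfolding S_def sym_def by (auto intro: rtrancl_into_rtrancl)
  define a where "a = restrict_vec S x"
  define b where "b = restrict_vec (- S) y"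
  have supp: "A \<in> supported E" and symA: "transpose A = A"
    using A by (auto simp: arnold_def psd_def)
  have a: "A *v a = 0" and b: "A *v b = 0"
    unfolding a_def b_def using S
    by (subst mult_restrict_vec[OF supp]; auto simp: x y vec_eq_iff)+
  define X :: "real^'v^'v" where "X = (\<chi> k. a $ k *\<^sub>R b + b $ k *\<^sub>R a)"
  \<comment> \<open>The supports of \<open>a\<close> and \<open>b\<close> are disjoint and no edge
    joins them, so every product contributing to a diagonal or edge entry vanishes.\<close>
  have X: "X \<in> hidden E"
    using S by (auto simp: hidden_def X_def vec_eq_iff transpose_def a_def b_def)
  then have "X ** A = 0"
    by (subst sym_mult_eq_0_iff[OF symA])
      (auto simp: hidden_def X_def matrix_vector_right_distrib matrix_vector_mult_scaleR a b)
  then have "X = 0"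
    using A X by (simp add: arnold_def sap_def)
  then have "X $ u $ i = 0" by simp
  then show ?thesis
    using i x by (simp add: X_def a_def b_def S_def)
qed

text \<open>Congruence by an invertible diagonal matrix respects the pattern of zeros, the rank and
  the strong Arnold property. With a nowhere-zero kernel vector of the component on the diagonal,
  the indicator of the component enters the kernel.\<close>

lemma arnold_normal_form:
  fixes A :: "real^'v^'v"
  assumes A: "arnold E F A" and E: "sym E" and x: "A *v x = 0" "x $ u \<noteq> 0"
  shows "\<exists>A'. arnold E F A' \<and> dim (null_space A') = dim (null_space A) \<and>
           A' *v (\<chi> i. if (u, i) \<in> E\<^sup>* then 1 else 0) = 0 \<and>
           (\<forall>z. A' *v z = 0 \<longrightarrow> (\<forall>i. (u, i) \<notin> E\<^sup>* \<longrightarrow> z $ i = 0))"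
proof -
  obtain B y where B: "arnold E F B" "B *v y = 0" "dim (null_space B) = dim (null_space A)"
      and y: "\<And>i. (u, i) \<in> E\<^sup>* \<Longrightarrow> y $ i \<noteq> 0"
    using arnold_full_kernel_vector[OF A E x] by blast
  have y0: "y $ i = 0" if "(u, i) \<notin> E\<^sup>*" for i
    using kernel_in_one_component[OF B(1) E B(2) y B(2) that] by simp
  \<comment> \<open>The value 1 keeps \<open>D\<close> invertible off the component, where
    \<open>y\<close> vanishes.\<close>
  define d where "d i = (if (u, i) \<in> E\<^sup>* then y $ i else 1)" for i
  have d: "d i \<noteq> 0" for i using y by (simp add: d_def)
  define D :: "real^'v^'v" where "D = (\<chi> i j. if i = j then d i else 0)"
  have Dv: "D *v z = (\<chi> i. d i * z $ i)" for z
  proof -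
    have "(\<Sum>j\<in>UNIV. (if i = j then d i else 0) * z $ j) = d i * z $ i" for i
      by (subst sum.cong[OF refl, of _ _ "\<lambda>j. if j = i then d i * z $ i else 0"]) auto
    then show ?thesis by (simp add: D_def matrix_vector_mult_def vec_eq_iff)
  qed
  have "transpose D = D" by (auto simp: D_def transpose_def vec_eq_iff)
  define A' where "A' = transpose D ** B ** D"
  have A'v: "A' *v z = D *v (B *v (D *v z))" for z
    unfolding A'_def \<open>transpose D = D\<close>
    by (simp add: matrix_vector_mul_assoc[symmetric] matrix_mul_assoc[symmetric])
  have D0: "D *v z = 0 \<longleftrightarrow> z = 0" for z
    using d by (simp add: Dv vec_eq_iff)
  have entry: "A' $ i $ j = d i * B $ i $ j * d j" for i j
  proof -
    have "A' $ i $ j = (A' *v axis j 1) $ i"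
      by (simp add: matrix_vector_mult_basis column_def)
    also have "D *v axis j 1 = d j *\<^sub>R axis j 1"
      by (auto simp: Dv vec_eq_iff axis_def)
    then have "(A' *v axis j 1) $ i = d i * B $ i $ j * d j"
      unfolding A'v by (simp add: matrix_vector_mult_scaleR matrix_vector_mult_basis column_def Dv)
    finally show ?thesis .
  qed
  have psd: "psd B" and supp: "B \<in> supported E" and sap: "sap E B"
    using B by (auto simp: arnold_def)
  have psd': "psd A'"
    unfolding A'_def by (rule psd_congruence[OF psd])
  have "arnold E F A'"
    unfolding arnold_def
  proof (intro conjI psd')
    show "A' \<in> supported E" using supp by (simp add: supported_def entry)
    show "\<forall>i j. (i, j) \<in> F \<longrightarrow> A' $ i $ j \<noteq> 0"
      using B(1) d by (auto simp: arnold_def entry)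
    show "sap E A'" unfolding sap_def
    proof (intro ballI impI)
      fix X assume X: "X \<in> hidden E" "X ** A' = 0"
      then have "transpose X = X" by (simp add: hidden_def)
      then have "B *v (D *v (X $ k)) = 0" for k
        using X by (simp add: sym_mult_eq_0_iff psd_sym[OF psd'] A'v D0)
      \<comment> \<open>This is \<open>D ** X ** D\<close>, which transfers a violation of the
        property from \<open>A'\<close> to \<open>B\<close>.\<close>
      moreover define Y :: "real^'v^'v" where "Y = (\<chi> k. d k *\<^sub>R (D *v (X $ k)))"
      ultimately have "B *v (Y $ k) = 0" for k
        by (simp add: matrix_vector_mult_scaleR)
      moreover have Y: "Y \<in> hidden E"
        using X sym_entry[OF \<open>transpose X = X\<close>]
        by (auto simp: hidden_def Y_def Dv transpose_def vec_eq_iff)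
      ultimately have "Y = 0"
        using sap by (simp add: sap_def hidden_def sym_mult_eq_0_iff psd_sym[OF psd])
      then show "X = 0"
        using d by (simp add: Y_def Dv vec_eq_iff)
    qed
  qed
  moreover have "dim (null_space A') = dim (null_space A)"
    unfolding A'_def B(3)[symmetric] using D0 by (intro dim_null_space_congruence[OF psd]) auto
  moreover have "D *v (\<chi> i. if (u, i) \<in> E\<^sup>* then 1 else 0) = y"
    using y0 by (simp add: Dv vec_eq_iff d_def)
  then have one: "A' *v (\<chi> i. if (u, i) \<in> E\<^sup>* then 1 else 0) = 0"
    by (simp add: A'v B)
  moreover have "z $ i = 0" if "A' *v z = 0" "(u, i) \<notin> E\<^sup>*" for z i
    by (rule kernel_in_one_component[OF calculation(1) E one _ that]) simp
  ultimately show ?thesis by blast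
qed

section \<open>Laplacians and components\<close>

lemma outer_entry: "outer u $ i $ j = u $ i * u $ j"
  by (simp add: outer_def columnvector_def rowvector_def matrix_matrix_mult_def)

lemma outer_mult: "outer u *v x = (u \<bullet> x) *\<^sub>R u"
  by (simp add: vec_eq_iff matrix_vector_mult_def outer_entry inner_vec_def sum_distrib_left
      mult_ac)

lemma edge_vecE:
  assumes "multigraph G" "e \<in> edges G"
  obtains a b where "ends G e = {a, b}" "a \<noteq> b" "a \<in> verts G" "b \<in> verts G"
    "edge_vec G e = axis a 1 - axis b 1"
proof -
  have *: "ends G e \<subseteq> verts G" "card (ends G e) = 2"
    using assms by (auto simp: multigraph_def)
  then have ex: "\<exists>i j. ends G e = {i, j}" by (auto simp: card_2_iff)
  have "\<exists>i j. ends G e = {i, j} \<and> edge_vec G e = axis i 1 - axis j 1"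
    unfolding edge_vec_def by (rule someI_ex) (use ex in blast)
  then obtain a b where ab: "ends G e = {a, b}" "edge_vec G e = axis a 1 - axis b 1"
    by blast
  moreover from ab * have "a \<noteq> b" by auto
  ultimately show ?thesis using * that by auto
qed

lemma edge_vec_inner:
  assumes "multigraph G" "e \<in> edges G" "ends G e = {i, j}"
  shows "(edge_vec G e \<bullet> x)\<^sup>2 = (x $ i - x $ j)\<^sup>2"
proof -
  obtain a b where ab: "ends G e = {a, b}" "edge_vec G e = axis a 1 - axis b 1"
    using edge_vecE[OF assms(1,2)] .
  then have "edge_vec G e \<bullet> x = x $ a - x $ b"
    by (simp add: inner_diff_left inner_axis')
  moreover have "a = i \<and> b = j \<or> a = j \<and> b = i"
    using ab assms(3) by (auto simp: doubleton_eq_iff)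
  ultimately show ?thesis by (auto simp: power2_commute)
qed

lemma edge_vec_outside:
  assumes "multigraph G" "e \<in> edges G" "i \<notin> ends G e"
  shows "edge_vec G e $ i = 0"
proof -
  obtain a b where "ends G e = {a, b}" "edge_vec G e = axis a 1 - axis b 1"
    using edge_vecE[OF assms(1,2)] .
  then show ?thesis using assms(3) by (simp add: axis_def)
qed

lemma laplacian_entry: "laplacian G \<omega> $ i $ j =
    (\<Sum>e\<in>edges G. \<omega> e * (edge_vec G e $ i * edge_vec G e $ j))"
  by (simp add: laplacian_def outer_entry)

lemma transpose_laplacian: "transpose (laplacian G \<omega>) = laplacian G \<omega>"
  unfolding vec_eq_iff transpose_def vec_lambda_beta laplacian_entry
  by (intro allI sum.cong refl) (simp add: mult_ac)

lemma laplacian_mult_sum: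
  "laplacian G \<omega> *v x = (\<Sum>e\<in>edges G. (\<omega> e * (edge_vec G e \<bullet> x)) *\<^sub>R edge_vec G e)"
proof -
  interpret mv: bounded_bilinear "(*v) :: real^'a^'a \<Rightarrow> real^'a \<Rightarrow> real^'a"
    by (rule bounded_bilinear_matrix_vector_mult)
  show ?thesis
    by (simp add: laplacian_def mv.sum_left mv.scaleR_left outer_mult)
qed

lemma laplacian_quadratic_form:
  "x \<bullet> (laplacian G \<omega> *v x) = (\<Sum>e\<in>edges G. \<omega> e * (edge_vec G e \<bullet> x)\<^sup>2)"
  by (simp add: laplacian_mult_sum inner_sum_right power2_eq_square inner_commute mult_ac)

text \<open>Each edge at \<open>i\<close> has exactly one opposite end, so the sum over edges
  regroups by that end. In this form the kernel equation is the equilibrium condition.\<close>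

lemma laplacian_mult:
  assumes G: "multigraph G"
  shows "(laplacian G \<omega> *v x) $ i =
    (\<Sum>j\<in>verts G. \<Sum>e\<in>joining G i j. \<omega> e * (x $ i - x $ j))"
proof -
  have fin: "finite (verts G)" "finite (edges G)" using G by (auto simp: multigraph_def)
  have edge: "(edge_vec G e \<bullet> x) * edge_vec G e $ i =
      (\<Sum>j\<in>verts G. if ends G e = {i, j} then x $ i - x $ j else 0)" if e: "e \<in> edges G" for e
  proof -
    obtain a b where ab: "ends G e = {a, b}" "a \<noteq> b" "a \<in> verts G" "b \<in> verts G"
        "edge_vec G e = axis a 1 - axis b 1"
      using edge_vecE[OF G e] .
    have inner: "edge_vec G e \<bullet> x = x $ a - x $ b"
      by (simp add: ab inner_diff_left inner_axis')
    have nth: "edge_vec G e $ i = (if i = a then 1 else if i = b then - 1 else 0)"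
      using ab by (auto simp: axis_def)
    \<comment> \<open>Only the end opposite to \<open>i\<close> contributes. If \<open>i\<close> is
      not an end, the selected index \<open>a\<close> carries the value 0.\<close>
    have "(\<Sum>j\<in>verts G. if ends G e = {i, j} then x $ i - x $ j else 0) =
        (\<Sum>j\<in>verts G. if j = (if i = a then b else a) then
           (if i = a then x $ a - x $ b else if i = b then x $ b - x $ a else 0) else 0)"
      by (rule sum.cong) (use ab in \<open>auto simp: doubleton_eq_iff\<close>)
    also have "\<dots> = (if i = a then x $ a - x $ b else if i = b then x $ b - x $ a else 0)"
      using ab fin by simp
    finally show ?thesis by (simp add: inner nth)
  qed
  have "(laplacian G \<omega> *v x) $ i = (\<Sum>e\<in>edges G. \<omega> e * ((edge_vec G e \<bullet> x) * edge_vec G e $ i))"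
    by (simp add: laplacian_mult_sum mult.assoc)
  also have "\<dots> = (\<Sum>e\<in>edges G. \<Sum>j\<in>verts G. if ends G e = {i, j} then \<omega> e * (x $ i - x $ j) else 0)"
    by (rule sum.cong) (auto simp: edge sum_distrib_left intro!: sum.cong)
  also have "\<dots> = (\<Sum>j\<in>verts G. \<Sum>e\<in>edges G. if ends G e = {i, j} then \<omega> e * (x $ i - x $ j) else 0)"
    by (rule sum.swap)
  also have "\<dots> = (\<Sum>j\<in>verts G. \<Sum>e\<in>joining G i j. \<omega> e * (x $ i - x $ j))"
    by (rule sum.cong) (simp_all add: joining_def sum.inter_filter fin)
  finally show ?thesis .
qed

lemma laplacian_off_diagonal:
  assumes G: "multigraph G" and "i \<noteq> j"
  shows "laplacian G \<omega> $ i $ j = - (\<Sum>e\<in>joining G i j. \<omega> e)"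
proof -
  have fin: "finite (verts G)" using G by (auto simp: multigraph_def)
  have "laplacian G \<omega> $ i $ j = (laplacian G \<omega> *v axis j 1) $ i"
    by (simp add: matrix_vector_mult_basis column_def)
  also have "\<dots> = (\<Sum>k\<in>verts G. if k = j then - (\<Sum>e\<in>joining G i j. \<omega> e) else 0)"
    unfolding laplacian_mult[OF G]
    by (rule sum.cong) (use \<open>i \<noteq> j\<close> in \<open>auto simp: axis_def sum_negf\<close>)
  also have "\<dots> = - (\<Sum>e\<in>joining G i j. \<omega> e)"
  proof (cases "j \<in> verts G")
    case False
    then have "joining G i j = {}" using G by (auto simp: joining_def multigraph_def)
    then show ?thesis by simp
  qed (simp add: fin)
  finally show ?thesis .
qed

section \<open>Adjacency and connected components\<close>

lemma joining_commute: "joining G i j = joining G j i"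
  by (simp add: joining_def insert_commute)

lemma sym_adj: "sym (adj G)"
  by (auto simp: sym_def adj_def joining_commute)

lemma adj_verts: "multigraph G \<Longrightarrow> (i, j) \<in> adj G \<Longrightarrow> i \<in> verts G \<and> j \<in> verts G \<and> i \<noteq> j"
  by (auto simp: adj_def joining_def multigraph_def card_2_iff)

definition component :: "('v, 'e) mgraph \<Rightarrow> 'v \<Rightarrow> 'v set" where
  "component G u = {w. (u, w) \<in> (adj G)\<^sup>*}"

lemma component_self: "u \<in> component G u"
  by (simp add: component_def)

lemma component_closed: "(i, j) \<in> adj G \<Longrightarrow> i \<in> component G u \<longleftrightarrow> j \<in> component G u"
  using sym_adj[of G] unfolding component_def sym_def mem_Collect_eq
  by (meson rtrancl_into_rtrancl)

lemma component_subset: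
  assumes "multigraph G" "u \<in> verts G"
  shows "component G u \<subseteq> verts G"
proof -
  have "w \<in> verts G" if "(u, w) \<in> (adj G)\<^sup>*" for w
    using that assms(2) by (induction rule: rtrancl_induct) (auto dest: adj_verts[OF assms(1)])
  then show ?thesis by (auto simp: component_def)
qed

lemma conn_components_eq:
  assumes "multigraph G"
  shows "conn_components G = (\<lambda>u. induced G (component G u)) ` verts G"
proof -
  have "((adj G)\<^sup>* \<inter> verts G \<times> verts G) `` {u} = component G u" if "u \<in> verts G" for u
    using component_subset[OF assms that] that by (auto simp: component_def)
  then have "verts G // ((adj G)\<^sup>* \<inter> verts G \<times> verts G) = component G ` verts G"
    by (auto simp: quotient_def)
  then show ?thesis by (simp add: conn_components_def image_image)
qed

lemma induced_simps [simp]: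
  "verts (induced G C) = C" "edges (induced G C) = {e \<in> edges G. ends G e \<subseteq> C}"
  "ends (induced G C) = ends G"
  by (simp_all add: induced_def)

lemma edge_vec_induced [simp]: "edge_vec (induced G C) = edge_vec G"
  by (simp add: edge_vec_def fun_eq_iff)

lemma multigraph_induced:
  assumes "multigraph G" "C \<subseteq> verts G"
  shows "multigraph (induced G C)"
  using assms finite_subset by (auto simp: multigraph_def)

lemma joining_induced:
  "joining (induced G C) i j = (if i \<in> C \<and> j \<in> C then joining G i j else {})"
  by (auto simp: joining_def)

lemma adj_induced: "adj (induced G C) = adj G \<inter> C \<times> C"
  by (auto simp: adj_def joining_induced split: if_splits)

section \<open>From super stable tensegrities to matrices\<close>

text \<open>The index \<open>l = d\<close> is the homogenizing coordinate, the all-one vector of \<open>C\<close>.\<close>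

definition hom_coord :: "'v set \<Rightarrow> nat \<Rightarrow> ('v \<Rightarrow> nat \<Rightarrow> real) \<Rightarrow> nat \<Rightarrow> real^'v" where
  "hom_coord C d p l = (\<chi> i. if i \<in> C then (if l < d then p i l else 1) else 0)"

lemma inner_supported:
  fixes f g :: "'n::finite \<Rightarrow> real"
  shows "(\<chi> i. if i \<in> C then f i else 0) \<bullet> (\<chi> i. if i \<in> C then g i else 0) =
     (\<Sum>i\<in>C. f i * g i)"
proof -
  have "(\<Sum>i\<in>UNIV. (if i \<in> C then f i else 0) * (if i \<in> C then g i else 0)) =
      (\<Sum>i\<in>C. f i * g i)"
    by (rule sum.mono_neutral_cong_right) auto
  then show ?thesis by (simp add: inner_vec_def)
qed

text \<open>Affine coefficients of the origin give the functional dual to the all-one vector.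
  Subtracting them from those of a unit vector leaves coefficient sum zero and reads off one
  coordinate.\<close>

lemma affinely_spanning_dual:
  fixes p :: "'v::finite \<Rightarrow> nat \<Rightarrow> real"
  assumes "affinely_spanning C d p"
  obtains \<gamma> where "\<And>k l. k \<le> d \<Longrightarrow> l \<le> d \<Longrightarrow>
    \<gamma> k \<bullet> hom_coord C d p l = (if k = l then 1 else 0)"
proof -
  obtain c where c: "\<And>x. (\<Sum>i\<in>C. c x i) = 1" "\<And>x k. k < d \<Longrightarrow> (\<Sum>i\<in>C. c x i * p i k) = x k"
    using assms unfolding affinely_spanning_def by metis
  define \<gamma> :: "nat \<Rightarrow> real^'v" where "\<gamma> k = (\<chi> i. if i \<in> C then
      (if k < d then c (\<lambda>m. if m = k then 1 else 0) i - c (\<lambda>_. 0) i else c (\<lambda>_. 0) i) else 0)" for k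
  have "\<gamma> k \<bullet> hom_coord C d p l = (if k = l then 1 else 0)" if "k \<le> d" "l \<le> d" for k l
    using that c
    by (cases "k < d"; cases "l < d")
      (auto simp: \<gamma>_def hom_coord_def inner_supported left_diff_distrib sum_subtractf)
  then show ?thesis using that by blast
qed

text \<open>Duality makes the \<open>d + 1\<close> vectors \<open>P l\<close> independent, so they
  span \<open>K\<close>, and \<open>\<gamma> k\<close> extracts the coefficient of
  \<open>P k\<close>.\<close>

lemma dual_expansion:
  fixes P \<gamma> :: "nat \<Rightarrow> 'a::euclidean_space"
  assumes dual: "\<And>k l. k \<le> d \<Longrightarrow> l \<le> d \<Longrightarrow> \<gamma> k \<bullet> P l = (if k = l then 1 else 0)"
    and K: "subspace K" "dim K = d + 1" "\<And>l. l \<le> d \<Longrightarrow> P l \<in> K" and "x \<in> K"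
  shows "x = (\<Sum>k\<le>d. (\<gamma> k \<bullet> x) *\<^sub>R P k)"
proof -
  have inner: "\<gamma> k \<bullet> (\<Sum>l\<le>d. u l *\<^sub>R P l) = u k" if "k \<le> d" for k u
  proof -
    have "\<gamma> k \<bullet> (\<Sum>l\<le>d. u l *\<^sub>R P l) = (\<Sum>l\<le>d. if l = k then u l else 0)"
      unfolding inner_sum_right by (rule sum.cong) (use dual that in auto)
    then show ?thesis using that by simp
  qed
  have inj: "inj_on P {..d}"
  proof (rule inj_onI)
    fix k l assume "k \<in> {..d}" "l \<in> {..d}" "P k = P l"
    then show "k = l" using dual[of k k] dual[of k l] by (auto split: if_splits)
  qed
  have "independent (P ` {..d})"
  proof (rule independent_if_scalars_zero)
    fix f v assume f: "(\<Sum>v\<in>P ` {..d}. f v *\<^sub>R v) = 0" and v: "v \<in> P ` {..d}"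
    then obtain k where k: "k \<le> d" "v = P k" by auto
    have "(\<Sum>l\<le>d. f (P l) *\<^sub>R P l) = 0"
      using f by (simp add: sum.reindex[OF inj])
    then show "f v = 0" using inner[OF k(1), of "\<lambda>l. f (P l)"] k by simp
  qed simp
  then have "K \<subseteq> span (P ` {..d})"
    using K by (intro card_ge_dim_independent) (auto simp: card_image[OF inj])
  then obtain u where "x = (\<Sum>v\<in>P ` {..d}. u v *\<^sub>R v)"
    using \<open>x \<in> K\<close> by (auto simp: span_finite)
  then have x: "x = (\<Sum>l\<le>d. u (P l) *\<^sub>R P l)"
    by (simp add: sum.reindex[OF inj])
  have "\<gamma> k \<bullet> x = u (P k)" if "k \<le> d" for k
    unfolding x by (rule inner[OF that])
  then have "(\<Sum>k\<le>d. (\<gamma> k \<bullet> x) *\<^sub>R P k) = (\<Sum>k\<le>d. u (P k) *\<^sub>R P k)"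
    by simp
  then show ?thesis by (simp only: x[symmetric])
qed

text \<open>Expanding first the rows and then the columns exhibits \<open>X\<close> as a bilinear
  form evaluated at the points with coordinates \<open>P k $ i\<close>.\<close>

lemma dual_expansion_matrix:
  fixes X :: "real^'v^'v"
  assumes dual: "\<And>k l. k \<le> d \<Longrightarrow> l \<le> d \<Longrightarrow> \<gamma> k \<bullet> P l = (if k = l then 1 else 0)"
    and K: "subspace K" "dim K = d + 1" "\<And>l. l \<le> d \<Longrightarrow> P l \<in> K"
    and X: "transpose X = X" "\<And>i. X $ i \<in> K"
  shows "X $ i $ j = (\<Sum>l\<le>d. \<Sum>k\<le>d. (\<gamma> k \<bullet> (X *v \<gamma> l)) * P k $ i * P l $ j)"
proof -
  have mem: "X *v w \<in> K" for w
  proof -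
    have "column j X = X $ j" for j
      by (simp add: column_def vec_eq_iff sym_entry[OF X(1), of _ j])
    then show ?thesis
      unfolding matrix_mult_sum by (auto intro!: subspace_sum subspace_scale K X simp: scalar_mult_eq_scaleR)
  qed
  have "X $ i = (\<Sum>l\<le>d. (\<gamma> l \<bullet> X $ i) *\<^sub>R P l)"
    by (rule dual_expansion[OF dual K X(2)])
  then have "X $ i $ j = (\<Sum>l\<le>d. (\<gamma> l \<bullet> X $ i) *\<^sub>R P l) $ j"
    by (rule arg_cong)
  also have "\<dots> = (\<Sum>l\<le>d. (X *v \<gamma> l) $ i * P l $ j)"
    by (simp add: matrix_vector_mul_component inner_commute)
  also have "\<dots> = (\<Sum>l\<le>d. \<Sum>k\<le>d. (\<gamma> k \<bullet> (X *v \<gamma> l)) * P k $ i * P l $ j)"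
  proof (rule sum.cong[OF refl])
    fix l
    have "(X *v \<gamma> l) $ i = (\<Sum>k\<le>d. (\<gamma> k \<bullet> (X *v \<gamma> l)) *\<^sub>R P k) $ i"
      using dual_expansion[OF dual K mem[of "\<gamma> l"]] by simp
    then show "(X *v \<gamma> l) $ i * P l $ j = (\<Sum>k\<le>d. (\<gamma> k \<bullet> (X *v \<gamma> l)) * P k $ i * P l $ j)"
      by (simp add: sum_distrib_right)
  qed
  finally show ?thesis .
qed

text \<open>\<open>X\<close> is a quadratic form \<open>S\<close> on the homogenized points. As its
  diagonal is zero, \<open>X $ i $ j\<close> is minus half the value of \<open>S\<close> at
  \<open>p j - p i\<close>, and vanishing on edges is exactly the conic condition.\<close>

lemma hidden_kernel_matrix_eq_0:
  fixes X :: "real^'v^'v"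
  assumes span: "affinely_spanning C d p" and conic: "\<not> edges_on_conic H d p"
    and adj: "adj H \<subseteq> C \<times> C"
    and K: "subspace K" "dim K = d + 1" "\<And>l. l \<le> d \<Longrightarrow> hom_coord C d p l \<in> K" "K \<subseteq> vecs_on C"
    and X: "X \<in> hidden (adj H)" "\<And>i. X $ i \<in> K"
  shows "X = 0"
proof -
  let ?P = "hom_coord C d p"
  have symX: "transpose X = X" using X by (simp add: hidden_def)
  obtain \<gamma> where dual: "\<And>k l. k \<le> d \<Longrightarrow> l \<le> d \<Longrightarrow> \<gamma> k \<bullet> ?P l = (if k = l then 1 else 0)"
    using affinely_spanning_dual[OF span] by blast
  define S where "S k l = \<gamma> k \<bullet> (X *v \<gamma> l)" for k l
  have symS: "S k l = S l k" for k l
    unfolding S_def by (subst inner_sym_matrix[OF symX], subst inner_commute) simp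
  have entry: "X $ i $ j = (\<Sum>l\<le>d. \<Sum>k\<le>d. S k l * ?P k $ i * ?P l $ j)" for i j
    unfolding S_def by (rule dual_expansion_matrix[OF dual K(1-3) symX X(2)])
  have diff: "X $ i $ i + X $ j $ j - 2 * X $ i $ j =
      (\<Sum>a<d. \<Sum>b<d. (p j a - p i a) * S a b * (p j b - p i b))" if "i \<in> C" "j \<in> C" for i j
  proof -
    have "X $ i $ i + X $ j $ j - X $ i $ j - X $ j $ i =
        (\<Sum>l\<le>d. \<Sum>k\<le>d. (?P k $ j - ?P k $ i) * S k l * (?P l $ j - ?P l $ i))"
      unfolding entry sum_subtractf[symmetric] sum.distrib[symmetric]
      by (intro sum.cong refl) (simp add: algebra_simps)
    \<comment> \<open>The index \<open>d\<close> drops out: the homogenizing coordinate equals 1 at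
      both vertices.\<close>
    also have "\<dots> = (\<Sum>l<d. \<Sum>k<d. (p j k - p i k) * S k l * (p j l - p i l))"
      using that by (simp add: lessThan_Suc_atMost[symmetric] hom_coord_def)
    also have "\<dots> = (\<Sum>a<d. \<Sum>b<d. (p j a - p i a) * S a b * (p j b - p i b))"
      by (rule sum.swap)
    finally show ?thesis using sym_entry[OF symX, of i j] by simp
  qed
  have diag: "X $ i $ i = 0" for i using X by (simp add: hidden_def)
  have "(\<Sum>a<d. \<Sum>b<d. (p j a - p i a) * S a b * (p j b - p i b)) = 0" if "(i, j) \<in> adj H" for i j
  proof -
    have "i \<in> C" "j \<in> C" "X $ i $ j = 0" using that adj X by (auto simp: hidden_def)
    then show ?thesis using diff[of i j] diag by simp
  qed
  then have "S a b = 0" if "a < d" "b < d" for a b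
    using conic that symS unfolding edges_on_conic_def by blast
  then have 0: "X $ i $ j = 0" if "i \<in> C" "j \<in> C" for i j
    using diff[OF that] diag by simp
  have "X $ i $ j = 0" if "j \<notin> C" for i j
    using X(2)[of i] K(4) that by (auto simp: vecs_on_def)
  then have "X $ i $ j = 0" for i j
    using 0 sym_entry[OF symX, of i j] by metis
  then show ?thesis by (simp add: vec_eq_iff)
qed

lemma hom_coord_in_kernel:
  assumes H: "multigraph H" and eq: "equilibrium_stress H d p \<omega>"
  shows "laplacian H \<omega> *v hom_coord (verts H) d p l = 0"
proof -
  have "(laplacian H \<omega> *v hom_coord (verts H) d p l) $ i = 0" for i
  proof (cases "i \<in> verts H")
    case True
    then have "(\<Sum>j\<in>verts H. \<Sum>e\<in>joining H i j. \<omega> e * (p i l - p j l)) = 0" if "l < d"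
    proof -
      have "(\<Sum>j\<in>verts H. \<Sum>e\<in>joining H i j. \<omega> e * (p i l - p j l)) =
          - (\<Sum>j\<in>verts H. \<Sum>e\<in>joining H i j. \<omega> e * (p j l - p i l))"
        unfolding sum_negf[symmetric] by (intro sum.cong refl) (simp add: algebra_simps)
      then show ?thesis using eq True that by (simp add: equilibrium_stress_def)
    qed
    with True show ?thesis
      unfolding laplacian_mult[OF H] by (cases "l < d") (simp_all add: hom_coord_def cong: sum.cong)
  next
    case False
    then have "joining H i j = {}" for j
      using H by (auto simp: joining_def multigraph_def)
    then show ?thesis by (simp add: laplacian_mult[OF H])
  qed
  then show ?thesis by (simp add: vec_eq_iff)
qed

text \<open>The Laplacian of the stress is completed by a positive definite block on the other
  components, which adds nothing to the kernel. Hence \<open>hidden_kernel_matrix_eq_0\<close>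
  yields the strong Arnold property for all of \<open>G\<close>.\<close>

lemma super_stable_imp_strong_arnold:
  fixes G :: "('v::finite, 'e) mgraph"
  assumes G: "multigraph G" and u: "u \<in> verts G"
    and ss: "super_stable (induced G (component G u)) d \<sigma> p"
  shows "\<exists>A\<in>cdv_matrices G. psd A \<and> strong_arnold G A \<and> ker_dim (verts G) A = d + 1"
proof -
  define C where "C = component G u"
  define H where "H = induced G C"
  have CV: "C \<subseteq> verts G" using component_subset[OF G u] by (simp add: C_def)
  have H: "multigraph H" unfolding H_def by (rule multigraph_induced[OF G CV])
  have finE: "finite (edges G)" using G by (simp add: multigraph_def)
  obtain \<omega> where \<omega>: "equilibrium_stress H d p \<omega>" "strictly_proper H \<sigma> \<omega>"
      "psd (laplacian H \<omega>)" "ker_dim C (laplacian H \<omega>) = d + 1"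
    and span: "affinely_spanning C d p" and conic: "\<not> edges_on_conic H d p"
    using ss unfolding super_stable_def H_def C_def by auto
  \<comment> \<open>Weight 1 elsewhere keeps the entries of single edges nonzero and the additional
    form nonnegative.\<close>
  define \<omega>' where "\<omega>' e = (if ends G e \<subseteq> C then \<omega> e else 1)" for e
  define A :: "real^'v^'v" where
    "A = laplacian G \<omega>' + coord_proj (verts G - C)"
  define R where "R = {e \<in> edges G. \<not> ends G e \<subseteq> C}"
  have edges_split: "edges G = edges H \<union> R" "edges H \<inter> R = {}"
    by (auto simp: H_def R_def)
  have fin: "finite (edges H)" "finite R"
    using finE by (simp_all add: H_def R_def)
  have quad: "x \<bullet> (A *v x) = x \<bullet> (laplacian H \<omega> *v x) + (\<Sum>e\<in>R. (edge_vec G e \<bullet> x)\<^sup>2) +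
      (\<Sum>i\<in>verts G - C. (x $ i)\<^sup>2)" for x
  proof -
    have "x \<bullet> (laplacian G \<omega>' *v x) =
        (\<Sum>e\<in>edges H. \<omega>' e * (edge_vec G e \<bullet> x)\<^sup>2) + (\<Sum>e\<in>R. \<omega>' e * (edge_vec G e \<bullet> x)\<^sup>2)"
      unfolding laplacian_quadratic_form edges_split(1)
      by (rule sum.union_disjoint[OF fin edges_split(2)])
    moreover have "(\<Sum>e\<in>edges H. \<omega>' e * (edge_vec G e \<bullet> x)\<^sup>2) = x \<bullet> (laplacian H \<omega> *v x)"
      unfolding laplacian_quadratic_form by (rule sum.cong) (auto simp: H_def \<omega>'_def)
    moreover have "(\<Sum>e\<in>R. \<omega>' e * (edge_vec G e \<bullet> x)\<^sup>2) = (\<Sum>e\<in>R. (edge_vec G e \<bullet> x)\<^sup>2)"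
      by (rule sum.cong) (auto simp: R_def \<omega>'_def)
    ultimately show ?thesis
      by (simp add: A_def matrix_vector_mult_add_rdistrib inner_add_right coord_proj_mult
          inner_restrict_vec_self)
  qed
  have H_nonneg: "0 \<le> x \<bullet> (laplacian H \<omega> *v x)" for x
    using \<omega> by (simp add: psd_def)
  have symA: "transpose A = A"
    using sym_entry[OF transpose_laplacian[of G \<omega>']]
    by (auto simp: A_def transpose_def vec_eq_iff)
  have psdA: "psd A"
    unfolding psd_def quad using H_nonneg symA by (auto intro!: add_nonneg_nonneg sum_nonneg)
  define K where "K = {x \<in> vecs_on C. laplacian H \<omega> *v x = 0}"
  \<comment> \<open>All three summands of \<open>quad\<close> are nonnegative, so they vanish
    together on the kernel: the last confines the support to \<open>C\<close>, the first gives the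
    kernel of the Laplacian of \<open>H\<close>.\<close>
  have kerA: "{x \<in> vecs_on (verts G). A *v x = 0} = K"
  proof (intro set_eqI iffI)
    fix x assume x: "x \<in> {x \<in> vecs_on (verts G). A *v x = 0}"
    then have "x \<bullet> (laplacian H \<omega> *v x) + (\<Sum>e\<in>R. (edge_vec G e \<bullet> x)\<^sup>2) +
        (\<Sum>i\<in>verts G - C. (x $ i)\<^sup>2) = 0"
      using quad[of x] by simp
    moreover have "0 \<le> (\<Sum>e\<in>R. (edge_vec G e \<bullet> x)\<^sup>2)" "0 \<le> (\<Sum>i\<in>verts G - C. (x $ i)\<^sup>2)"
      by (auto intro: sum_nonneg)
    ultimately have "x \<bullet> (laplacian H \<omega> *v x) = 0" "(\<Sum>i\<in>verts G - C. (x $ i)\<^sup>2) = 0"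
      using H_nonneg[of x] by linarith+
    moreover from this have "x $ i = 0" if "i \<in> verts G - C" for i
      using that by (subst (asm) sum_nonneg_eq_0_iff) auto
    ultimately show "x \<in> K"
      using x psd_kernel[OF \<omega>(3)] by (auto simp: K_def vecs_on_def)
  next
    fix x assume x: "x \<in> K"
    then have x0: "x $ i = 0" if "i \<notin> C" for i using that by (simp add: K_def vecs_on_def)
    have "edge_vec G e \<bullet> x = 0" if e: "e \<in> R" for e
    proof -
      have eG: "e \<in> edges G" using e by (simp add: R_def)
      obtain a b where ab: "ends G e = {a, b}" "edge_vec G e = axis a 1 - axis b 1"
        using edge_vecE[OF G eG] .
      have "(a, b) \<in> adj G" using ab eG by (auto simp: adj_def joining_def)
      then have "a \<notin> C" "b \<notin> C"
        using component_closed[of a b G u] e ab by (auto simp: R_def C_def)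
      then show ?thesis by (simp add: ab x0 inner_diff_left inner_axis')
    qed
    then have "x \<bullet> (A *v x) = 0"
      using x x0 by (simp add: quad K_def)
    then have "A *v x = 0" by (rule psd_kernel[OF psdA])
    then show "x \<in> {x \<in> vecs_on (verts G). A *v x = 0}"
      using x0 CV by (auto simp: vecs_on_def)
  qed
  have "ker_dim (verts G) A = d + 1"
    using \<omega>(4) by (simp add: ker_dim_def kerA K_def)
  moreover have "A \<in> cdv_matrices G"
  proof -
    have "A $ i $ j = 0" if "i \<notin> verts G \<or> j \<notin> verts G" for i j
    proof -
      have "edge_vec G e $ i * edge_vec G e $ j = 0" if "e \<in> edges G" for e
        using \<open>i \<notin> verts G \<or> j \<notin> verts G\<close> edge_vec_outside[OF G that] G that
        by (auto simp: multigraph_def)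
      then have "laplacian G \<omega>' $ i $ j = 0"
        unfolding laplacian_entry by (intro sum.neutral ballI) simp
      then show ?thesis using that by (auto simp: A_def)
    qed
    moreover have "A $ i $ j = - (\<Sum>e\<in>joining G i j. \<omega>' e)" if "i \<noteq> j" for i j
      using that by (simp add: A_def laplacian_off_diagonal[OF G])
    moreover have "\<omega>' e \<noteq> 0" if "e \<in> edges G" for e
      using \<omega>(2) that by (auto simp: \<omega>'_def strictly_proper_def H_def)
    moreover from this have "(\<Sum>e\<in>joining G i j. \<omega>' e) \<noteq> 0" if c1: "card (joining G i j) = 1" for i j
    proof -
      obtain e where e: "joining G i j = {e}" using card_1_singletonE[OF c1] .
      then have "e \<in> joining G i j" by simp
      then have "e \<in> edges G" by (simp add: joining_def)
      then show ?thesis using \<open>\<And>e. e \<in> edges G \<Longrightarrow> \<omega>' e \<noteq> 0\<close> e by simp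
    qed
    moreover have "finite (joining G i j)" for i j
      using finE by (simp add: joining_def)
    ultimately show ?thesis
      using symA by (auto simp: cdv_matrices_def mats_on_def)
  qed
  moreover have "strong_arnold G A"
    unfolding strong_arnold_def
  proof (intro notI, elim bexE conjE)
    fix X assume X: "X \<in> mats_on (verts G)" "X \<noteq> 0" "transpose X = X" "X ** A = 0"
      and X0: "\<forall>i\<in>verts G. \<forall>j\<in>verts G. i = j \<or> (i, j) \<in> adj G \<longrightarrow> X $ i $ j = 0"
    have row: "X $ i \<in> K" for i
      unfolding kerA[symmetric] using X
      by (simp add: sym_mult_eq_0_iff[OF symA X(3)] vecs_on_def mats_on_def)
    have "X $ i $ j = 0" if "i = j \<or> (i, j) \<in> adj G" for i j
      using that X0 X(1) by (cases "i \<in> verts G \<and> j \<in> verts G") (auto simp: mats_on_def)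
    then have "X \<in> hidden (adj H)"
      using X(3) by (auto simp: hidden_def H_def adj_induced)
    moreover have "subspace K"
      by (auto simp: K_def subspace_def vecs_on_def matrix_vector_right_distrib
          matrix_vector_mult_scaleR)
    moreover have "hom_coord C d p l \<in> K" for l
      using hom_coord_in_kernel[OF H \<omega>(1)] by (simp add: K_def H_def hom_coord_def vecs_on_def)
    ultimately have "X = 0"
      using \<omega>(4) row
      by (intro hidden_kernel_matrix_eq_0[OF span conic, of K])
        (auto simp: H_def adj_induced K_def ker_dim_def)
    then show False using X by simp
  qed
  ultimately show ?thesis using psdA by blast
qed

section \<open>From matrices to super stable tensegrities\<close>

text \<open>Give one element the remainder and all \<open>n\<close> others the same value
  \<open>c\<close>. The choice \<open>c = 1\<close> fails only for \<open>s = real n\<close>; then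
  \<open>c = 2\<close> leaves the remainder \<open>- real n\<close>, nonzero because a singleton
  would have \<open>s = 0\<close>.\<close>

lemma ex_nonzero_with_sum:
  fixes s :: real
  assumes J: "finite J" "J \<noteq> {}" and s: "card J = 1 \<Longrightarrow> s \<noteq> 0"
  shows "\<exists>f. (\<forall>e\<in>J. f e \<noteq> 0) \<and> (\<Sum>e\<in>J. f e) = s"
proof -
  obtain e where e: "e \<in> J" using J by auto
  define n where "n = card (J - {e})"
  have sum: "(\<Sum>x\<in>J. if x = e then s - c * real n else c) = s" for c
  proof -
    have "(\<Sum>x\<in>J - {e}. if x = e then s - c * real n else c) = (\<Sum>x\<in>J - {e}. c)"
      by (rule sum.cong) auto
    then show ?thesis using J e by (simp add: sum.remove[of J e] n_def)
  qed
  show ?thesis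
  proof (cases "s = real n")
    case False
    then show ?thesis
      using sum[of 1] by (intro exI[of _ "\<lambda>x. if x = e then s - 1 * real n else 1"]) auto
  next
    case True
    have "n \<noteq> 0"
    proof
      assume "n = 0"
      then have "card J = 1" using card_Suc_Diff1[OF J(1) e] by (simp add: n_def)
      then show False using s True \<open>n = 0\<close> by simp
    qed
    then show ?thesis
      using sum[of 2] True
      by (intro exI[of _ "\<lambda>x. if x = e then s - 2 * real n else 2"]) auto
  qed
qed

text \<open>Writing \<open>p j\<close> plus the unit vector in direction \<open>a\<close> as an
  affine combination of the points, the functional \<open>l\<close> takes the value
  \<open>l a\<close> on that direction and 0 on each difference.\<close>

lemma affinely_spanning_orthogonal:
  assumes "affinely_spanning C d p" "\<And>m. m \<in> C \<Longrightarrow> (\<Sum>a<d. (p m a - p j a) * l a) = 0" "a < d"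
  shows "l a = 0"
proof -
  obtain c where c: "(\<Sum>m\<in>C. c m) = 1"
      "\<And>k. k < d \<Longrightarrow> p j k + (if k = a then 1 else 0) = (\<Sum>m\<in>C. c m * p m k)"
    using assms(1)[unfolded affinely_spanning_def,
        THEN spec, of "\<lambda>k. p j k + (if k = a then 1 else 0)"] by blast
  have "0 = (\<Sum>m\<in>C. c m * (\<Sum>a<d. (p m a - p j a) * l a))"
    using assms(2) by simp
  also have "\<dots> = (\<Sum>m\<in>C. \<Sum>k<d. (c m * p m k - c m * p j k) * l k)"
    by (simp add: sum_distrib_left algebra_simps)
  also have "\<dots> = (\<Sum>k<d. \<Sum>m\<in>C. (c m * p m k - c m * p j k) * l k)"
    by (rule sum.swap)
  also have "\<dots> = (\<Sum>k<d. if k = a then l k else 0)"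
  proof (rule sum.cong[OF refl])
    fix k assume "k \<in> {..<d}"
    then have k: "k < d" by simp
    have "(\<Sum>m\<in>C. (c m * p m k - c m * p j k) * l k) =
        ((\<Sum>m\<in>C. c m * p m k) - (\<Sum>m\<in>C. c m) * p j k) * l k"
      by (simp add: sum_distrib_right sum_subtractf left_diff_distrib)
    then show "(\<Sum>m\<in>C. (c m * p m k - c m * p j k) * l k) = (if k = a then l k else 0)"
      using c(1) by (simp add: c(2)[OF k, symmetric])
  qed
  also have "\<dots> = l a" using \<open>a < d\<close> by simp
  finally show ?thesis by simp
qed

lemma inner_restrict_vec: "x \<bullet> restrict_vec S y = restrict_vec S x \<bullet> y"
  by (auto simp: inner_vec_def intro!: sum.cong)

lemma mult_vec_supported:
  fixes x :: "real^'n"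
  assumes "\<And>j. j \<notin> C \<Longrightarrow> x $ j = 0"
  shows "(A *v x) $ i = (\<Sum>j\<in>C. A $ i $ j * x $ j)"
  unfolding matrix_vector_mult_def vec_lambda_beta
  by (rule sum.mono_neutral_right) (use assms in auto)

text \<open>Extend the indicator of \<open>C\<close> to a basis of the kernel; the other
  \<open>d\<close> basis vectors are the coordinate functions of the points.\<close>

lemma kernel_basis_affinely_spanning:
  fixes A :: "real^'v^'v"
  assumes one: "A *v (\<chi> i. if i \<in> C then 1 else 0) = 0" and ne: "u \<in> C"
    and ker: "\<And>z i. A *v z = 0 \<Longrightarrow> i \<notin> C \<Longrightarrow> z $ i = 0"
    and dim: "dim (null_space A) = d + 1"
  obtains h where "\<And>k. k < d \<Longrightarrow> A *v h k = 0" "affinely_spanning C d (\<lambda>i k. h k $ i)"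
proof -
  let ?o = "(\<chi> i. if i \<in> C then 1 else 0) :: real^'v"
  have "?o $ u \<noteq> 0" using ne by simp
  then have "?o \<noteq> 0" by (metis zero_index)
  then have "independent {?o}" by simp
  moreover have "{?o} \<subseteq> null_space A" using one by simp
  ultimately obtain B where B: "{?o} \<subseteq> B" "B \<subseteq> null_space A" "independent B"
      "null_space A \<subseteq> span B"
    using maximal_independent_subset_extend[of "{?o}" "null_space A"] by metis
  have finB: "finite B" using B(3) by (rule independent_imp_finite)
  have "card B = d + 1" using B(2-4) dim basis_card_eq_dim by metis
  then have "card (B - {?o}) = d" using B(1) finB by simp
  then obtain h where h: "bij_betw h {0..<d} (B - {?o})"
    using ex_bij_betw_nat_finite[of "B - {?o}"] finB by auto
  have hB: "h k \<in> B - {?o}" if "k < d" for k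
    using bij_betw_apply[OF h, of k] that by simp
  show ?thesis
  proof (rule that)
    show "A *v h k = 0" if "k < d" for k using hB[OF that] B(2) by auto
    show "affinely_spanning C d (\<lambda>i k. h k $ i)"
      unfolding affinely_spanning_def
    proof
      fix x :: "nat \<Rightarrow> real"
      \<comment> \<open>The affine coefficients are the values of \<open>g\<close> on unit vectors:
        the value 1 at the indicator makes their sum 1, the other prescribed values produce
        \<open>x\<close>.\<close>
      obtain g :: "real^'v \<Rightarrow> real" where g: "linear g"
          "\<forall>b\<in>B. g b = (if b = ?o then 1 else x (the_inv_into {0..<d} h b))"
        using linear_independent_extend[OF B(3),
            of "\<lambda>b. if b = ?o then 1 else x (the_inv_into {0..<d} h b)"] by blast
      have gsum: "g y = (\<Sum>i\<in>C. g (axis i 1) * y $ i)" if "\<And>i. i \<notin> C \<Longrightarrow> y $ i = 0" for y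
      proof -
        have "g y = g (\<Sum>i\<in>UNIV. y $ i *\<^sub>R axis i 1)"
          using basis_expansion[of y] by (simp add: scalar_mult_eq_scaleR)
        also have "\<dots> = (\<Sum>i\<in>UNIV. y $ i * g (axis i 1))"
          by (simp add: linear_sum[OF g(1)] linear_cmul[OF g(1)])
        also have "\<dots> = (\<Sum>i\<in>C. g (axis i 1) * y $ i)"
          by (rule sum.mono_neutral_cong_right) (use that in auto)
        finally show ?thesis .
      qed
      have "x k = (\<Sum>i\<in>C. g (axis i 1) * h k $ i)" if "k < d" for k
      proof -
        have "g (h k) = x k"
          using g(2) hB[OF that] that h
          by (auto simp: bij_betw_def the_inv_into_f_f)
        moreover have "A *v h k = 0" using hB[OF that] B(2) by auto
        ultimately show ?thesis using gsum[of "h k"] ker by simp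
      qed
      moreover have "(\<Sum>i\<in>C. g (axis i 1)) = 1"
        using gsum[of ?o] g(2) B(1) by simp
      ultimately show "\<exists>c. sum c C = 1 \<and> (\<forall>k<d. x k = (\<Sum>i\<in>C. c i * h k $ i))"
        by (intro exI[of _ "\<lambda>i. g (axis i 1)"]) auto
    qed
  qed
qed

text \<open>For a form \<open>S\<close> vanishing on the edge directions, \<open>X i j = S(p j - p i, p j - p i)\<close> is affine in
  \<open>p j\<close> up to terms killed by \<open>A\<close>, so \<open>X A = 0\<close>.\<close>
lemma sap_imp_not_on_conic:
  fixes A :: "real^'v^'v"
  assumes A: "transpose A = A" "A \<in> supported E" "sap E A"
    and E: "\<And>i j. (i, j) \<in> E \<Longrightarrow> i \<in> C \<longleftrightarrow> j \<in> C" and H: "adj H = E \<inter> C \<times> C"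
    and one: "\<And>i. (\<Sum>j\<in>C. A $ i $ j) = 0"
    and p: "\<And>i k. k < d \<Longrightarrow> (\<Sum>j\<in>C. A $ i $ j * p j k) = 0"
    and span: "affinely_spanning C d p" and u: "u \<in> C"
  shows "\<not> edges_on_conic H d p"
proof
  assume "edges_on_conic H d p"
  then obtain S where S: "\<And>a b. a < d \<Longrightarrow> b < d \<Longrightarrow> S a b = S b a" "\<exists>a<d. \<exists>b<d. S a b \<noteq> (0::real)"
      "\<And>i j. (i, j) \<in> adj H \<Longrightarrow> (\<Sum>a<d. \<Sum>b<d. (p j a - p i a) * S a b * (p j b - p i b)) = 0"
    unfolding edges_on_conic_def by blast
  define q where "q i j = (\<Sum>a<d. \<Sum>b<d. (p j a - p i a) * S a b * (p j b - p i b))" for i j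
  define l where "l i j a = (\<Sum>b<d. S a b * (p j b - p i b))" for i j a
  have q_comm: "q i j = q j i" for i j
    unfolding q_def by (intro sum.cong refl) (simp add: algebra_simps)
  \<comment> \<open>Polarization along \<open>p m - p i = (p m - p j) + (p j - p i)\<close>.\<close>
  have q_expand: "q i m = q j m + q i j + 2 * (\<Sum>a<d. (p m a - p j a) * l i j a)" for i j m
  proof -
    let ?D = "\<lambda>a. p m a - p j a" and ?E = "\<lambda>a. p j a - p i a"
    have "q i m - q j m - q i j =
        (\<Sum>a<d. \<Sum>b<d. ?D a * S a b * ?E b) + (\<Sum>a<d. \<Sum>b<d. ?E a * S a b * ?D b)"
      unfolding q_def sum_subtractf[symmetric] sum.distrib[symmetric]
      by (intro sum.cong refl) (simp add: algebra_simps)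
    also have "(\<Sum>a<d. \<Sum>b<d. ?E a * S a b * ?D b) = (\<Sum>b<d. \<Sum>a<d. ?E a * S a b * ?D b)"
      by (rule sum.swap)
    also have "\<dots> = (\<Sum>a<d. \<Sum>b<d. ?D a * S a b * ?E b)"
      by (intro sum.cong refl) (simp add: S(1) mult_ac)
    also have "(\<Sum>a<d. \<Sum>b<d. ?D a * S a b * ?E b) = (\<Sum>a<d. ?D a * l i j a)"
      by (simp add: l_def sum_distrib_left mult_ac)
    finally show ?thesis by simp
  qed
  \<comment> \<open>Expanding around \<open>j\<close>, the terms \<open>q j m\<close> vanish
    wherever row \<open>j\<close> of \<open>A\<close> can be nonzero. The remainder is affine in
    \<open>p m\<close> and is annihilated by that row.\<close>
  have A_q: "(\<Sum>m\<in>C. A $ j $ m * q i m) = 0" if "i \<in> C" "j \<in> C" for i j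
  proof -
    have "A $ j $ m * q j m = 0" if "m \<in> C" for m
      using S(3)[of j m] H A(2) that \<open>j \<in> C\<close> by (cases "j = m") (auto simp: q_def supported_def)
    then have "(\<Sum>m\<in>C. A $ j $ m * q j m) = 0"
      by (intro sum.neutral ballI)
    moreover have "(\<Sum>m\<in>C. A $ j $ m * (\<Sum>a<d. (p m a - p j a) * l i j a)) = 0"
    proof -
      have "(\<Sum>m\<in>C. A $ j $ m * (\<Sum>a<d. (p m a - p j a) * l i j a)) =
          (\<Sum>m\<in>C. \<Sum>a<d. (A $ j $ m * p m a - A $ j $ m * p j a) * l i j a)"
        by (simp add: sum_distrib_left algebra_simps)
      also have "\<dots> = (\<Sum>a<d. \<Sum>m\<in>C. (A $ j $ m * p m a - A $ j $ m * p j a) * l i j a)"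
        by (rule sum.swap)
      also have "\<dots> = (\<Sum>a<d. ((\<Sum>m\<in>C. A $ j $ m * p m a) - (\<Sum>m\<in>C. A $ j $ m) * p j a) * l i j a)"
        by (simp add: sum_distrib_right sum_subtractf left_diff_distrib)
      finally show ?thesis by (simp add: one p)
    qed
    moreover have "(\<Sum>m\<in>C. A $ j $ m * q i m) = (\<Sum>m\<in>C. A $ j $ m * q j m) +
        (\<Sum>m\<in>C. A $ j $ m) * q i j + 2 * (\<Sum>m\<in>C. A $ j $ m * (\<Sum>a<d. (p m a - p j a) * l i j a))"
      unfolding sum_distrib_right sum_distrib_left[of 2] sum.distrib[symmetric]
      by (intro sum.cong refl, subst q_expand[of i _ j]) (simp add: algebra_simps)
    ultimately show ?thesis by (simp add: one)
  qed
  define X :: "real^'v^'v" where "X = (\<chi> i j. if i \<in> C \<and> j \<in> C then q i j else 0)"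
  have X_hidden: "X \<in> hidden E"
  proof -
    have "q i j = 0" if "i = j \<or> (i, j) \<in> E" "i \<in> C" "j \<in> C" for i j
      using that(1)
    proof
      assume "(i, j) \<in> E"
      then have "(i, j) \<in> adj H" using that(2,3) H by blast
      then show ?thesis unfolding q_def by (rule S(3))
    qed (simp add: q_def)
    then show ?thesis by (auto simp: hidden_def X_def transpose_def vec_eq_iff q_comm)
  qed
  have "A *v (X $ i) = 0" for i
  proof -
    have "(A *v (X $ i)) $ j = 0" for j
    proof -
      have "(A *v (X $ i)) $ j = (\<Sum>m\<in>C. A $ j $ m * X $ i $ m)"
        by (rule mult_vec_supported) (simp add: X_def)
      also have "\<dots> = 0"
      proof (cases "i \<in> C \<and> j \<in> C")
        case True
        then show ?thesis using A_q by (simp add: X_def cong: sum.cong)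
      next
        case False
        have "A $ j $ m * X $ i $ m = 0" if "m \<in> C" for m
        proof (cases "i \<in> C")
          case True
          then have "j \<noteq> m" "(j, m) \<notin> E" using False E[of j m] that by auto
          then show ?thesis using A(2) by (simp add: supported_def)
        qed (simp add: X_def)
        then show ?thesis by (intro sum.neutral ballI)
      qed
      finally show ?thesis .
    qed
    then show ?thesis by (simp add: vec_eq_iff)
  qed
  then have "X ** A = 0"
    using X_hidden by (subst sym_mult_eq_0_iff[OF A(1)]) (auto simp: hidden_def)
  then have "X = 0" using A(3) X_hidden by (simp add: sap_def)
  then have q0: "q i j = 0" if "i \<in> C" "j \<in> C" for i j
  proof -
    have "X $ i $ j = 0" using \<open>X = 0\<close> by simp
    then show ?thesis using that by (simp add: X_def)
  qed
  \<comment> \<open>With \<open>q\<close> zero on \<open>C\<close>, polarization makes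
    \<open>l i j\<close> orthogonal to all point differences. The same spanning argument is then
    applied to each row of \<open>S\<close>.\<close>
  have l0: "l i j a = 0" if "i \<in> C" "j \<in> C" "a < d" for i j a
  proof (rule affinely_spanning_orthogonal[OF span _ \<open>a < d\<close>])
    fix m assume "m \<in> C"
    then show "(\<Sum>a<d. (p m a - p j a) * l i j a) = 0"
      using q_expand[of i m j] q0 that by simp
  qed
  have "S a b = 0" if "a < d" "b < d" for a b
  proof (rule affinely_spanning_orthogonal[OF span _ \<open>b < d\<close>])
    fix m assume "m \<in> C"
    then show "(\<Sum>b<d. (p m b - p u b) * S a b) = 0"
      using l0[of u m a] u that by (simp add: l_def mult.commute)
  qed
  then show False using S(2) by blast
qed

text \<open>Each class of parallel edges is treated separately: its weights must be nonzero and sum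
  to a prescribed number, which is nonzero for a class of one edge.\<close>

lemma ex_edge_weights:
  assumes G: "multigraph G" and symA: "transpose A = A"
    and A1: "\<And>i j. card (joining G i j) = 1 \<Longrightarrow> A $ i $ j \<noteq> 0"
  obtains \<omega> where "\<And>e. e \<in> edges G \<Longrightarrow> \<omega> e \<noteq> (0::real)"
    "\<And>i j. joining G i j \<noteq> {} \<Longrightarrow> (\<Sum>e\<in>joining G i j. \<omega> e) = - A $ i $ j"
proof -
  have fin: "finite (joining G i j)" for i j
    using G by (simp add: joining_def multigraph_def)
  have "\<exists>f. \<forall>i j. ends G e0 = {i, j} \<longrightarrow>
      (\<forall>e\<in>joining G i j. f e \<noteq> 0) \<and> (\<Sum>e\<in>joining G i j. f e) = - A $ i $ j"
    if e0: "e0 \<in> edges G" for e0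
  proof -
    obtain a b where ab: "ends G e0 = {a, b}" using edge_vecE[OF G e0] .
    then have "joining G a b \<noteq> {}" using e0 by (auto simp: joining_def)
    then obtain f where f: "\<forall>e\<in>joining G a b. f e \<noteq> 0" "(\<Sum>e\<in>joining G a b. f e) = - A $ a $ b"
      using ex_nonzero_with_sum[OF fin, of a b "- A $ a $ b"] A1[of a b] by auto
    have "(\<forall>e\<in>joining G i j. f e \<noteq> 0) \<and> (\<Sum>e\<in>joining G i j. f e) = - A $ i $ j"
      if "ends G e0 = {i, j}" for i j
    proof -
      have "i = a \<and> j = b \<or> i = b \<and> j = a" using that ab by (auto simp: doubleton_eq_iff)
      then show ?thesis
        using f joining_commute[of G a b] sym_entry[OF symA, of a b] by auto
    qed
    then show ?thesis by blast
  qed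
  then obtain F where F: "\<And>e0 i j. e0 \<in> edges G \<Longrightarrow> ends G e0 = {i, j} \<Longrightarrow>
      (\<forall>e\<in>joining G i j. F e0 e \<noteq> 0) \<and> (\<Sum>e\<in>joining G i j. F e0 e) = - A $ i $ j"
    by metis
  \<comment> \<open>Choosing one representative per pair of ends makes all parallel edges take their
    weights from the same function.\<close>
  define r where "r P = (SOME e. e \<in> edges G \<and> ends G e = P)" for P
  have r: "r P \<in> edges G" "ends G (r P) = P" if "e \<in> edges G" "ends G e = P" for e P
    unfolding r_def using someI_ex[of "\<lambda>e. e \<in> edges G \<and> ends G e = P"] that by blast+
  define \<omega> where "\<omega> e = F (r (ends G e)) e" for e
  show ?thesis
  proof (rule that)
    fix e assume e: "e \<in> edges G"
    obtain a b where ab: "ends G e = {a, b}" using edge_vecE[OF G e] .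
    then show "\<omega> e \<noteq> 0"
      using F[OF r[OF e ab]] e unfolding \<omega>_def by (auto simp: joining_def)
  next
    fix i j assume "joining G i j \<noteq> {}"
    then obtain e where e: "e \<in> edges G" "ends G e = {i, j}" by (auto simp: joining_def)
    have "(\<Sum>e\<in>joining G i j. \<omega> e) = (\<Sum>e\<in>joining G i j. F (r {i, j}) e)"
      by (rule sum.cong) (auto simp: \<omega>_def joining_def)
    then show "(\<Sum>e\<in>joining G i j. \<omega> e) = - A $ i $ j"
      using F[OF r[OF e]] by simp
  qed
qed

text \<open>With the indicator of the component in the kernel, the row sums vanish, so the block of
  \<open>A\<close> on the component is a weighted Laplacian. A kernel basis supplies the points and
  the signs of the weights supply \<open>\<sigma>\<close>.\<close>

lemma super_stable_realization:
  fixes G :: "('v::finite, 'e) mgraph"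
  assumes G: "multigraph G" and u: "u \<in> verts G"
    and A: "arnold (adj G) {(i, j). card (joining G i j) = 1} A"
    and one: "A *v (\<chi> i. if i \<in> component G u then 1 else 0) = 0"
    and ker: "\<And>z i. A *v z = 0 \<Longrightarrow> i \<notin> component G u \<Longrightarrow> z $ i = 0"
    and dim: "dim (null_space A) = d + 1"
  shows "\<exists>\<sigma> p. super_stable (induced G (component G u)) d \<sigma> p"
proof -
  define C where "C = component G u"
  define H where "H = induced G C"
  have C: "u \<in> C" "C \<subseteq> verts G"
    using component_self component_subset[OF G u] by (auto simp: C_def)
  have H: "multigraph H" unfolding H_def by (rule multigraph_induced[OF G C(2)])
  have closed: "i \<in> C \<longleftrightarrow> j \<in> C" if "(i, j) \<in> adj G" for i j
    unfolding C_def by (rule component_closed[OF that])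
  have psdA: "psd A" and symA: "transpose A = A" and supp: "A \<in> supported (adj G)"
      and sapA: "sap (adj G) A"
    and A1: "\<And>i j. card (joining G i j) = 1 \<Longrightarrow> A $ i $ j \<noteq> 0"
    using A by (auto simp: arnold_def psd_def)
  obtain \<omega> where \<omega>: "\<And>e. e \<in> edges G \<Longrightarrow> \<omega> e \<noteq> 0"
      "\<And>i j. joining G i j \<noteq> {} \<Longrightarrow> (\<Sum>e\<in>joining G i j. \<omega> e) = - A $ i $ j"
    using ex_edge_weights[OF G symA A1] by blast
  obtain h where h: "\<And>k. k < d \<Longrightarrow> A *v h k = 0" "affinely_spanning C d (\<lambda>i k. h k $ i)"
    using kernel_basis_affinely_spanning[OF one[folded C_def] C(1) ker[folded C_def] dim] by blast
  have hC: "h k $ i = 0" if "k < d" "i \<notin> C" for k i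
    using ker[OF h(1)[OF that(1)]] that(2) by (simp add: C_def)
  have row_sum: "(\<Sum>j\<in>C. A $ i $ j) = 0" for i
  proof -
    have "(A *v (\<chi> i. if i \<in> C then 1 else 0)) $ i = 0" using one by (simp add: C_def)
    then show ?thesis by (subst (asm) mult_vec_supported[of C]) (simp_all cong: sum.cong)
  qed
  have A_restrict: "A *v restrict_vec C x = restrict_vec C (A *v x)" for x
    by (rule mult_restrict_vec[OF supp closed])
  \<comment> \<open>The weights match the off-diagonal entries; zero row sums account for the
    diagonal.\<close>
  have lap: "laplacian H \<omega> *v x = A *v restrict_vec C x" for x
  proof -
    have "(laplacian H \<omega> *v x) $ i = (A *v restrict_vec C x) $ i" for i
    proof (cases "i \<in> C")
      case True
      have "(\<Sum>e\<in>joining H i j. \<omega> e * (x $ i - x $ j)) = A $ i $ j * x $ j - A $ i $ j * x $ i"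
        if "j \<in> C" for j
      proof -
        have "(\<Sum>e\<in>joining G i j. \<omega> e) = - A $ i $ j" if "i \<noteq> j"
        proof (cases "joining G i j = {}")
          case True
          then have "(i, j) \<notin> adj G" by (simp add: adj_def)
          then have "A $ i $ j = 0" using supp that by (simp add: supported_def)
          then show ?thesis using True by simp
        qed (rule \<omega>(2))
        then have "(\<Sum>e\<in>joining G i j. \<omega> e) * (x $ i - x $ j) = - A $ i $ j * (x $ i - x $ j)"
          by (cases "i = j") simp_all
        moreover have "joining H i j = joining G i j"
          using True that by (simp add: H_def joining_induced)
        ultimately show ?thesis
          by (simp add: sum_distrib_right[symmetric]) (simp add: algebra_simps)
      qed
      then have "(laplacian H \<omega> *v x) $ i = (\<Sum>j\<in>C. A $ i $ j * x $ j) - (\<Sum>j\<in>C. A $ i $ j) * x $ i"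
        unfolding laplacian_mult[OF H] by (simp add: H_def sum_subtractf sum_distrib_right)
      also have "\<dots> = (\<Sum>j\<in>C. A $ i $ j * x $ j)" by (simp add: row_sum)
      also have "\<dots> = (A *v restrict_vec C x) $ i"
        by (subst mult_vec_supported[of C]) (auto intro: sum.cong)
      finally show ?thesis .
    next
      case False
      then show ?thesis
        unfolding laplacian_mult[OF H] A_restrict by (simp add: H_def joining_induced)
    qed
    then show ?thesis by (simp add: vec_eq_iff)
  qed
  have restrict_id: "restrict_vec C x = x" if "x \<in> vecs_on C" for x
    using that by (auto simp: vecs_on_def vec_eq_iff)
  have "psd (laplacian H \<omega>)"
  proof -
    have "x \<bullet> (laplacian H \<omega> *v x) = restrict_vec C x \<bullet> (A *v restrict_vec C x)" for x
    proof -
      have idem: "A *v restrict_vec C x = restrict_vec C (A *v restrict_vec C x)"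
        by (simp add: A_restrict vec_eq_iff)
      then show ?thesis
        unfolding lap by (subst idem) (rule inner_restrict_vec)
    qed
    then show ?thesis
      using psdA by (simp add: psd_def transpose_laplacian)
  qed
  moreover have "{x \<in> vecs_on C. laplacian H \<omega> *v x = 0} = null_space A"
    using ker by (auto simp: lap restrict_id vecs_on_def C_def[symmetric])
  then have "ker_dim C (laplacian H \<omega>) = d + 1"
    by (simp add: ker_dim_def dim)
  moreover have "equilibrium_stress H d (\<lambda>i k. h k $ i) \<omega>"
    unfolding equilibrium_stress_def
  proof (intro ballI allI impI)
    fix i k assume "k < d"
    have "h k \<in> vecs_on C" using hC[OF \<open>k < d\<close>] by (simp add: vecs_on_def)
    then have "(laplacian H \<omega> *v h k) $ i = 0"
      by (simp add: lap restrict_id h(1)[OF \<open>k < d\<close>])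
    moreover have "(\<Sum>j\<in>verts H. \<Sum>e\<in>joining H i j. \<omega> e * (h k $ j - h k $ i)) =
        - (laplacian H \<omega> *v h k) $ i"
      unfolding laplacian_mult[OF H] sum_negf[symmetric]
      by (intro sum.cong refl) (simp add: algebra_simps)
    ultimately show "(\<Sum>j\<in>verts H. \<Sum>e\<in>joining H i j. \<omega> e * (h k $ j - h k $ i)) = 0"
      by simp
  qed
  moreover have "strictly_proper H (\<lambda>e. sgn (\<omega> e)) \<omega>"
    using \<omega>(1) by (simp add: strictly_proper_def H_def mult.commute[of "sgn _"] abs_sgn[symmetric])
  moreover have "\<forall>e\<in>edges H. sgn (\<omega> e) \<in> {1, - 1}"
    using \<omega>(1) by (auto simp: H_def sgn_if)
  moreover have "\<not> edges_on_conic H d (\<lambda>i k. h k $ i)"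
  proof (rule sap_imp_not_on_conic[OF symA supp sapA closed _ row_sum _ h(2) C(1)])
    show "adj H = adj G \<inter> C \<times> C" by (simp add: H_def adj_induced)
    show "(\<Sum>j\<in>C. A $ i $ j * h k $ j) = 0" if "k < d" for i k
      using mult_vec_supported[of C "h k" A i] hC[OF that] h(1)[OF that] by simp
  qed
  ultimately have "super_stable H d (\<lambda>e. sgn (\<omega> e)) (\<lambda>i k. h k $ i)"
    using h(2) by (auto simp: super_stable_def H_def)
  then show ?thesis unfolding H_def C_def by blast
qed

text \<open>A nonzero kernel vector, available since the corank is positive, selects the component;
  the normal form on it satisfies the assumptions of
  \<open>super_stable_realization\<close>.\<close>

lemma strong_arnold_imp_super_stable:
  fixes G :: "('v::finite, 'e) mgraph"
  assumes G: "multigraph G" and A: "A \<in> cdv_matrices G" "psd A" "strong_arnold G A"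
    and dim: "ker_dim (verts G) A = d + 1"
  shows "\<exists>u\<in>verts G. \<exists>\<sigma> p. super_stable (induced G (component G u)) d \<sigma> p"
proof -
  let ?F = "{(i, j). card (joining G i j) = 1}"
  \<comment> \<open>The identity off the vertex set keeps the indices of the type outside it out of the kernel.\<close>
  define B where "B = A + coord_proj (- verts G)"
  have matsA: "A \<in> mats_on (verts G)" and symA: "transpose A = A"
    using A by (auto simp: cdv_matrices_def)
  have symB: "transpose B = B"
    using sym_entry[OF symA] by (auto simp: B_def transpose_def vec_eq_iff)
  have Bv: "B *v x = A *v x + restrict_vec (- verts G) x" for x
    by (simp add: B_def matrix_vector_mult_add_rdistrib coord_proj_mult)
  have psdB: "psd B"
    using A(2) symB unfolding psd_def Bv inner_add_right inner_restrict_vec_self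
    by (auto intro!: add_nonneg_nonneg sum_nonneg)
  have A0: "(A *v x) $ i = 0" if "i \<notin> verts G" for x i
    using matsA that by (simp add: mats_on_def matrix_vector_mult_def)
  have kerB: "null_space B = {x \<in> vecs_on (verts G). A *v x = 0}"
  proof (intro set_eqI iffI)
    fix x assume "x \<in> null_space B"
    have B0: "(A *v x) $ i + restrict_vec (- verts G) x $ i = 0" for i
    proof -
      have "A *v x + restrict_vec (- verts G) x = 0"
        using \<open>x \<in> null_space B\<close> by (simp add: Bv)
      then have "(A *v x + restrict_vec (- verts G) x) $ i = 0" by (simp only: zero_index)
      then show ?thesis by (simp only: vector_add_component)
    qed
    have "x $ i = 0" if "i \<notin> verts G" for i using B0[of i] A0[OF that] that by simp
    moreover from this have "(A *v x) $ i = 0" for i using B0[of i] by (simp split: if_splits)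
    ultimately show "x \<in> {x \<in> vecs_on (verts G). A *v x = 0}"
      by (simp add: vecs_on_def vec_eq_iff)
  next
    fix x assume "x \<in> {x \<in> vecs_on (verts G). A *v x = 0}"
    then show "x \<in> null_space B" by (auto simp: Bv vecs_on_def vec_eq_iff)
  qed
  have finJ: "finite (joining G i j)" for i j
    using G by (simp add: joining_def multigraph_def)
  have "arnold (adj G) ?F B"
    unfolding arnold_def
  proof (intro conjI psdB)
    show "B \<in> supported (adj G)"
    proof -
      have "A $ i $ j = 0" if "i \<noteq> j" "(i, j) \<notin> adj G" for i j
        using that A(1) by (cases "i \<in> verts G \<and> j \<in> verts G")
          (auto simp: cdv_matrices_def mats_on_def adj_def)
      then show ?thesis by (auto simp: supported_def B_def)
    qed
    show "\<forall>i j. (i, j) \<in> ?F \<longrightarrow> B $ i $ j \<noteq> 0"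
    proof (intro allI impI)
      fix i j assume "(i, j) \<in> ?F"
      then have c: "card (joining G i j) = 1" by simp
      then have "(i, j) \<in> adj G" by (auto simp: adj_def)
      then have "i \<in> verts G \<and> j \<in> verts G \<and> i \<noteq> j" by (rule adj_verts[OF G])
      then show "B $ i $ j \<noteq> 0" using A(1) c by (auto simp: cdv_matrices_def B_def)
    qed
    show "sap (adj G) B"
      unfolding sap_def
    proof (intro ballI impI)
      fix X assume X: "X \<in> hidden (adj G)" "X ** B = 0"
      then have symX: "transpose X = X" by (simp add: hidden_def)
      have row: "X $ i \<in> {x \<in> vecs_on (verts G). A *v x = 0}" for i
        unfolding kerB[symmetric] using X by (simp add: sym_mult_eq_0_iff[OF symB symX])
      have col: "X $ i $ j = 0" if "j \<notin> verts G" for i j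
        using row[of i] that by (simp add: vecs_on_def)
      have "X $ i $ j = 0" if "i \<notin> verts G \<or> j \<notin> verts G" for i j
        using that col sym_entry[OF symX, of i j] by auto
      then have "X \<in> mats_on (verts G)"
        by (simp add: mats_on_def)
      moreover have "X ** A = 0"
        using row by (simp add: sym_mult_eq_0_iff[OF symA symX])
      ultimately show "X = 0"
        using A(3) X(1) symX unfolding strong_arnold_def hidden_def by blast
    qed
  qed
  have dimB: "dim (null_space B) = d + 1"
    using dim by (simp add: kerB ker_dim_def)
  have "\<not> null_space B \<subseteq> {0}"
  proof
    assume "null_space B \<subseteq> {0}"
    then have "dim (null_space B) = 0" by (simp only: dim_eq_0)
    then show False using dimB by simp
  qed
  then obtain x where "B *v x = 0" "x \<noteq> 0" by auto
  then obtain u where x: "B *v x = 0" "x $ u \<noteq> 0" by (auto simp: vec_eq_iff[of x])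
  then have "x \<in> vecs_on (verts G)" using kerB by blast
  then have u: "u \<in> verts G" using x(2) by (auto simp: vecs_on_def)
  obtain B' where B': "arnold (adj G) ?F B'" "dim (null_space B') = dim (null_space B)"
      "B' *v (\<chi> i. if (u, i) \<in> (adj G)\<^sup>* then 1 else 0) = 0"
      "\<forall>z. B' *v z = 0 \<longrightarrow> (\<forall>i. (u, i) \<notin> (adj G)\<^sup>* \<longrightarrow> z $ i = 0)"
    using arnold_normal_form[OF \<open>arnold (adj G) ?F B\<close> sym_adj x] by blast
  have "\<exists>\<sigma> p. super_stable (induced G (component G u)) d \<sigma> p"
    by (rule super_stable_realization[OF G u B'(1)])
      (use B' dimB in \<open>auto simp: component_def\<close>)
  then show ?thesis using u by blast
qed

text \<open>Unit weights on a connected graph leave only the constants in the kernel, and dimension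
  0 admits no nonzero form. This makes the sets of dimensions nonempty, so that their maxima are
  attained.\<close>

lemma super_stable_0:
  fixes G :: "('v::finite, 'e) mgraph"
  assumes G: "multigraph G" and u: "u \<in> verts G"
  shows "super_stable (induced G (component G u)) 0 (\<lambda>_. 1) p"
proof -
  define C where "C = component G u"
  define H where "H = induced G C"
  have C: "u \<in> C" "C \<subseteq> verts G"
    using component_self component_subset[OF G u] by (auto simp: C_def)
  have H: "multigraph H" unfolding H_def by (rule multigraph_induced[OF G C(2)])
  let ?L = "laplacian H (\<lambda>_. 1)" and ?o = "(\<chi> i. if i \<in> C then 1 else 0) :: real^'v"
  have psdL: "psd ?L"
    by (auto simp: psd_def transpose_laplacian laplacian_quadratic_form intro: sum_nonneg)
  have "{x \<in> vecs_on C. ?L *v x = 0} = span {?o}"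
  proof (intro set_eqI iffI)
    fix x assume x: "x \<in> {x \<in> vecs_on C. ?L *v x = 0}"
    then have "(\<Sum>e\<in>edges H. (edge_vec H e \<bullet> x)\<^sup>2) = 0"
      using laplacian_quadratic_form[of x H "\<lambda>_. 1"] by simp
    then have e0: "(edge_vec H e \<bullet> x)\<^sup>2 = 0" if "e \<in> edges H" for e
      using that H by (subst (asm) sum_nonneg_eq_0_iff) (auto simp: multigraph_def)
    have x_step: "x $ i = x $ j" if ij: "i \<in> C" "(i, j) \<in> adj G" for i j
    proof -
      have "j \<in> C" using component_closed[OF ij(2)] ij(1) by (simp add: C_def)
      then obtain e where "e \<in> edges H" "ends H e = {i, j}"
        using ij by (auto simp: adj_def joining_def H_def)
      then have "(x $ i - x $ j)\<^sup>2 = 0"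
        using e0 edge_vec_inner[OF H, of e i j x] by simp
      then show ?thesis by simp
    qed
    have const: "x $ w = x $ u \<and> w \<in> C" if "(u, w) \<in> (adj G)\<^sup>*" for w
      using that
    proof (induction rule: rtrancl_induct)
      case (step a b)
      then show ?case
        using x_step[of a b] component_closed[OF step(2)] by (simp add: C_def)
    qed (use C in simp)
    define c where "c = x $ u"
    have "x $ i = (if i \<in> C then c else 0)" for i
    proof (cases "i \<in> C")
      case True
      then show ?thesis using const[of i] by (simp add: C_def component_def c_def)
    next
      case False
      then show ?thesis using x by (simp add: vecs_on_def)
    qed
    then have "x = c *\<^sub>R ?o" by (simp add: vec_eq_iff)
    then show "x \<in> span {?o}" unfolding span_singleton by (rule range_eqI)
  next
    fix x assume "x \<in> span {?o}"
    then obtain c where x: "x = c *\<^sub>R ?o" by (auto simp: span_singleton)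
    have "(?L *v x) $ i = 0" for i
      unfolding laplacian_mult[OF H]
      by (intro sum.neutral ballI) (simp add: x H_def joining_induced split: if_splits)
    then have "?L *v x = 0" by (simp add: vec_eq_iff)
    then show "x \<in> {x \<in> vecs_on C. ?L *v x = 0}" by (simp add: x vecs_on_def)
  qed
  moreover have "?o \<noteq> 0" using C(1) by (auto simp: vec_eq_iff)
  ultimately have "ker_dim C ?L = 1"
    by (simp add: ker_dim_def)
  moreover have "affinely_spanning C 0 p"
    unfolding affinely_spanning_def using C(1)
    by (auto intro!: exI[of _ "\<lambda>i. if i = u then 1 else 0"])
  ultimately show ?thesis
    using psdL unfolding super_stable_def H_def[symmetric] C_def[symmetric]
    by (auto intro!: exI[of _ "\<lambda>_. 1"] simp: H_def equilibrium_stress_def strictly_proper_def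
        edges_on_conic_def)
qed

section \<open>Comparison of the two maxima\<close>

theorem theorem4p6:
  fixes G :: "('v::finite, 'e) mgraph"
  assumes "multigraph G" and "verts G \<noteq> {}"
  shows "int (lambda G) = int (nu G) - 1"
proof -
  note G = \<open>multigraph G\<close>
  define N where "N = {ker_dim (verts G) A | A. A \<in> cdv_matrices G \<and> psd A \<and> strong_arnold G A}"
  define D where "D u = {d. \<exists>\<sigma> p. super_stable (induced G (component G u)) d \<sigma> p}" for u
  have "ker_dim (verts G) A \<le> DIM(real^'v)" for A
    unfolding ker_dim_def by (rule dim_subset_UNIV)
  then have finN: "finite N"
    by (intro finite_subset[of N "{..DIM(real^'v)}"]) (auto simp: N_def)
  \<comment> \<open>The shift by one accounts for the all-one kernel vector of the
    component.\<close>
  have DN: "d + 1 \<in> N" if "u \<in> verts G" "d \<in> D u" for u d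
    using super_stable_imp_strong_arnold[OF G that(1)] that(2) unfolding D_def N_def by force
  have nu: "nu G = Max N" by (simp add: nu_def N_def)
  have D_le: "d + 1 \<le> nu G" if "u \<in> verts G" "d \<in> D u" for u d
    unfolding nu by (rule Max_ge[OF finN DN[OF that]])
  have D0: "0 \<in> D u" if "u \<in> verts G" for u
    using super_stable_0[OF G that] unfolding D_def by blast
  have finD: "finite (D u)" if "u \<in> verts G" for u
    using D_le[OF that] by (intro finite_subset[of "D u" "{..nu G}"]) (auto dest: Suc_leD)
  have lambda_connected: "lambda_connected (induced G (component G u)) = Max (D u)" for u
    by (simp add: lambda_connected_def D_def)
  obtain u0 where u0: "u0 \<in> verts G" using assms(2) by blast
  \<comment> \<open>Positivity makes the natural-number subtraction \<open>nu G - 1\<close>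
    exact.\<close>
  have nu_pos: "nu G \<ge> 1" using D_le[OF u0 D0[OF u0]] by simp
  have "nu G \<in> N"
    unfolding nu using DN[OF u0 D0[OF u0]] finN by (intro Max_in) auto
  then obtain A where A: "A \<in> cdv_matrices G" "psd A" "strong_arnold G A"
      "ker_dim (verts G) A = nu G - 1 + 1"
    using nu_pos by (auto simp: N_def)
  then obtain u where u: "u \<in> verts G" "nu G - 1 \<in> D u"
    using strong_arnold_imp_super_stable[OF G] unfolding D_def by blast
  have "lambda G = Max ((\<lambda>u. Max (D u)) ` verts G)"
    by (simp add: lambda_def conn_components_eq[OF G] image_image lambda_connected)
  also have "\<dots> = nu G - 1"
  proof (rule Max_eqI)
    fix y assume "y \<in> (\<lambda>u. Max (D u)) ` verts G"
    then obtain v where v: "v \<in> verts G" "y = Max (D v)" by blast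
    then have "y \<in> D v" using Max_in[OF finD] D0 by blast
    then show "y \<le> nu G - 1" using D_le[OF v(1)] by fastforce
  next
    have "Max (D u) = nu G - 1"
      using D_le[OF u(1)] u by (intro Max_eqI finD) fastforce+
    then show "nu G - 1 \<in> (\<lambda>u. Max (D u)) ` verts G"
      using u(1) by force
  qed simp
  finally show ?thesis using nu_pos by simp
qed

end
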